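(* Let $\{\mathbf{Z}_n; n\ge 0\}$ be the Galton-Watson branching process with countably infinitely many types, with offspring law $P$ and generating function $\mathbf{F}$, described in the context, satisfying assumptions A1, A2, A3 stated there. Let $\Lambda$ be the set of fixed points of $\mathbf{F}$ in $[0,1]^{\mathbb{N}}$ and let $\Theta$ be the set of extinction probability vectors. If $M\le 1$, then $\Theta=\Lambda=\{\mathbf{1}\}$. If $M>1$, then $\Lambda$ has at least countably infinitely many elements (i.e. $\Lambda$ is infinite), while $\Theta=\{q\mathbf{1},\mathbf{1}\}$, where $q$ is the unique solution in $(0,1)$ of $F_0(s)=s$. Moreover, for any $\mathbf{r}=(r^{(i)})_{i\ge1}\in\Lambda\setminus\Theta$, it holds that $$\lim_{i\to\infty}\frac{1-r^{(i+1)}}{1-r^{(i)}}=\gamma,$$ where $\gamma$ is the unique solution in $(0,1)$ of the equation $\sum_{i=1}^{\infty}M_i s^{i-1}=1$.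
   Context: $\mathbb{N}=\{1,2,\dots\}$ is the set of types; $\mathbf{1}$ and $\mathbf{0}$ are the infinite vectors of ones and zeros; $\mathbf{e}_i$ is the infinite vector with $i$-th entry $1$ and all others $0$. Process: $P(j_1,j_2,\dots)$ is a probability distribution on sequences of nonnegative integers with finite sum. Particles reproduce independently; a particle of type $i$ has, with probability $P(j_1,j_2,\dots)$, exactly $j_k$ offspring of type $i+k-1$ for each $k\ge1$. $\mathbf{Z}_n=(Z_n^{(1)},Z_n^{(2)},\dots)$ is the vector of numbers of particles of each type in generation $n$, and $|\mathbf{Z}_n|$ is the total number of particles. The generating function is $\mathbf{F}(\mathbf{s})=(F^{(1)}(\mathbf{s}),F^{(2)}(\mathbf{s}),\dots)$ with $$F^{(i)}(\mathbf{s})=\sum_{j_1,j_2,\dots\ge0}P(j_1,j_2,\dots)\prod_{k=1}^\infty s_{i+k-1}^{j_k},\qquad \mathbf{s}=(s_1,s_2,\dots)\in[0,1]^{\mathbb{N}}.$$ Means: the mean matrix is $\mathbf{M}=(m_{ik})$ with $m_{ik}=\frac{\partial F^{(i)}}{\partial s_k}(\mathbf{1})$; $M_k=m_{1k}$ for $k\ge1$ and $M=\sum_{k\ge1}M_k$. Assumptions: A1: for any $k\ge i\ge1$ there is a positive integer $n$ with $(\mathbf{M}^n)_{ik}>0$. A2: $P(\mathbf{0})>0$ and $\mathbb{P}(|\mathbf{Z}_1|>1)>0$ (the process being started from a single particle). A3: $M_1<1$ and $M<\infty$. Extinction probabilities and fixed points: for $\mathcal{T}\subset\mathbb{N}$,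 $\mathbf{q}(\mathcal{T})=(q^{(i)}(\mathcal{T}))_{i\ge1}$ with $q^{(i)}(\mathcal{T})=\mathbb{P}\big(\lim_{n\to\infty}\sum_{l\in\mathcal{T}}Z_n^{(l)}=0\,\big|\,\mathbf{Z}_0=\mathbf{e}_i\big)$. Then $\Theta=\{\mathbf{q}(\mathcal{T}):\mathcal{T}\subset\mathbb{N}\}$ and $\Lambda=\{\mathbf{s}\in[0,1]^{\mathbb{N}}:\mathbf{F}(\mathbf{s})=\mathbf{s}\}$. $F_0(s)=\sum_{k=0}^\infty\sum_{|\mathbf{j}|=k}P(\mathbf{j})s^k$, where $|\mathbf{j}|=j_1+j_2+\cdots$, is the probability generating function of the total number of offspring of a particle; when $M>1$ the equation $F_0(s)=s$ has a unique solution in $(0,1)$, and the equation $\sum_{i\ge1}M_is^{i-1}=1$ has a unique solution in $(0,1)$. *)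

theory Defs
  imports "HOL-Probability.Probability" "HOL-Library.Multiset"
begin

text \<open>
  Types are numbered from 0, so the type written \<open>i\<close> in the usual numbering 1, 2, ... is the
  natural number \<open>i - 1\<close> here.  A sequence \<open>(j\<^sub>1, j\<^sub>2, \<dots>)\<close> of nonnegative integers with finite sum is
  the multiset \<open>j\<close> over \<^typ>\<open>nat\<close> with \<open>count j k = j\<^bsub>k+1\<^esub>\<close>, and its sum is \<open>size j\<close>.  A particle of
  type \<open>i\<close> whose offspring sequence is \<open>j\<close> has \<open>count j k\<close> children of type \<open>i + k\<close>.
\<close>

definition gen_fun :: "nat multiset pmf \<Rightarrow> nat \<Rightarrow> (nat \<Rightarrow> real) \<Rightarrow> real" where
  "gen_fun P i s = measure_pmf.expectation P (\<lambda>j. \<Prod>k\<in>set_mset j. s (i + k) ^ count j k)"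

definition total_gen_fun :: "nat multiset pmf \<Rightarrow> real \<Rightarrow> real" where
  "total_gen_fun P s = (\<Sum>k. measure_pmf.prob P {j. size j = k} * s ^ k)"

text \<open>
  The partial derivative of \<open>gen_fun P i\<close> at the all-ones vector in direction \<open>k\<close>.  That vector is
  on the boundary of the unit cube, so the derivative is one-sided; the difference quotients are
  nonnegative, and their limit is taken in \<^typ>\<open>ennreal\<close> because it may be infinite.
\<close>

definition mean_matrix :: "nat multiset pmf \<Rightarrow> nat \<Rightarrow> nat \<Rightarrow> ennreal" where
  "mean_matrix P i k = Lim (at_left (1::real))
     (\<lambda>t. ennreal ((gen_fun P i (\<lambda>_. 1) - gen_fun P i ((\<lambda>_. 1)(k := t))) / (1 - t)))"

fun mat_power :: "(nat \<Rightarrow> nat \<Rightarrow> ennreal) \<Rightarrow> nat \<Rightarrow> nat \<Rightarrow> nat \<Rightarrow> ennreal" where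
  "mat_power A 0 i k = (if i = k then 1 else 0)"
| "mat_power A (Suc n) i k = (\<Sum>l. mat_power A n i l * A l k)"

definition type_mean :: "nat multiset pmf \<Rightarrow> nat \<Rightarrow> ennreal" where
  "type_mean P k = mean_matrix P 0 k"

definition total_mean :: "nat multiset pmf \<Rightarrow> ennreal" where
  "total_mean P = (\<Sum>k. type_mean P k)"

text \<open>
  The canonical realisation of the process: the coordinates of \<open>gw_space P\<close> are independent with
  law \<open>P\<close>, and the coordinate \<open>(n, t, l)\<close> is the offspring sequence of the \<open>l\<close>-th particle of type \<open>t\<close>
  in generation \<open>n\<close>.  A generation is the multiset of the types of its particles.
\<close>

definition gw_space :: "nat multiset pmf \<Rightarrow> (nat \<times> nat \<times> nat \<Rightarrow> nat multiset) measure" where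
  "gw_space P = (\<Pi>\<^sub>M _\<in>UNIV. measure_pmf P)"

primrec gw_process ::
  "nat \<Rightarrow> (nat \<times> nat \<times> nat \<Rightarrow> nat multiset) \<Rightarrow> nat \<Rightarrow> nat multiset" where
  "gw_process i \<omega> 0 = {#i#}"
| "gw_process i \<omega> (Suc n) =
     (\<Sum>t\<in>set_mset (gw_process i \<omega> n). \<Sum>l<count (gw_process i \<omega> n) t.
        image_mset (\<lambda>k. t + k) (\<omega> (n, t, l)))"

definition extinction_prob :: "nat multiset pmf \<Rightarrow> nat set \<Rightarrow> nat \<Rightarrow> real" where
  "extinction_prob P T i = measure (gw_space P)
     {\<omega> \<in> space (gw_space P). (\<lambda>n. size {#l \<in># gw_process i \<omega> n. l \<in> T#}) \<longlonglongrightarrow> 0}"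

definition extinction_vectors :: "nat multiset pmf \<Rightarrow> (nat \<Rightarrow> real) set" where
  "extinction_vectors P = {extinction_prob P T | T. True}"

definition fixed_points :: "nat multiset pmf \<Rightarrow> (nat \<Rightarrow> real) set" where
  "fixed_points P = {s. (\<forall>i. s i \<in> {0..1}) \<and> (\<forall>i. gen_fun P i s = s i)}"

end

theory Submission
  imports Defs
begin

text \<open>
  Types never decrease and the offspring law is the same, up to a shift, for all types.  So the process
  is a branching random walk with nonnegative steps, the type being the position.  Write
  \<open>G s\<close> for the generating function at type 0, \<open>f x\<close> for its value at the constant function \<open>x\<close>, and
  \<open>m\<^sub>k\<close> for the mean number of children \<open>k\<close> types up.  A fixed point satisfies
  \<open>r i = G (\<lambda>k. r (i + k))\<close>.

  Two facts are used throughout.  First, the supremum \<open>B\<close> of a fixed point over the types above some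
  level satisfies \<open>B \<le> f B\<close>, and its infimum \<open>I\<close> satisfies \<open>f I \<le> I\<close>; in one variable these are
  understood (\<open>secant_slope\<close>).  If the total mean is at most 1, then \<open>f x > x\<close> for \<open>x < 1\<close>, and the
  constant 1 is the only fixed point.  If the mean is above 1, then \<open>f x < x\<close> exactly between the extinction root \<open>q\<close>
  and 1.  Secondly, as \<open>m\<^sub>0 < 1\<close>, values at a type can be compared once they are compared at
  higher types (\<open>comparison\<close>).

  In the supercritical case let \<open>y j\<close> be the probability that a particle has no descendant exactly \<open>j\<close> types
  up (\<open>level_pgf 0 j\<close>).  Truncating the steps without losing supercriticality gives \<open>y j \<le> 1 - \<alpha>\<close> for some \<open>\<alpha> > 0\<close>
  (\<open>level_pgf_bounded\<close>), and a limit of tail suprema improves this to \<open>limsup y \<le> q\<close>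
  (\<open>level_pgf_eventually_less\<close>).  Three conclusions are drawn.

  \<^item> Extinction.  If the particles with types in an infinite set die out, all distant types of this set are
  missed, which has probability at most \<open>limsup y \<le> q\<close>; and the whole population dies out with
  probability \<open>q\<close>.  A finite set dies out almost surely by Borel-Cantelli: as \<open>m\<^sub>0 < 1\<close>, the mean
  number of generations in which a given type occurs is finite.

  \<^item> Infinitely many fixed points.  Replace the value 0 at the level by \<open>s\<close>, which moves \<open>y j\<close>
  continuously from a number near or below \<open>q\<close> to 1.  So for each \<open>x\<close> between \<open>q\<close> and 1 there
  are solutions below every distant level with value \<open>x\<close> at type 0; a pointwise limit of them is a
  fixed point.

  \<^item> Ratios.  For a fixed point other than \<open>q\<close> and 1, the supremum over every tail is 1.  Put
  \<open>u = 1 - r\<close>.  Then \<open>\<alpha> * u k \<le> u i\<close> for \<open>i \<le> k\<close>, because a particle of type \<open>i\<close> reaches type \<open>k\<close> with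
  probability at least \<open>\<alpha>\<close> (\<open>fixed_point_quasi_decreasing\<close>); hence \<open>u\<close> tends to 0.  The same bound
  gives compactness and dominated convergence for the functions \<open>k \<mapsto> u (n + k) / u n\<close>, and their limits
  \<open>w\<close> solve the linear equation \<open>w i = (\<Sum>k. m\<^sub>k * w (i + k))\<close>.  Starting at
  types whose ratio \<open>u (n + 1) / u n\<close> approaches the limit superior or inferior \<open>\<gamma>\<close>, a maximum principle
  shows \<open>w k = \<gamma>\<^sup>k\<close> (\<open>harmonic_extremal_ratio\<close>), so \<open>(\<Sum>k. m\<^sub>k * \<gamma>\<^sup>k) = 1\<close>.  This equation has a
  single root, so the ratios converge to it.
\<close>

section \<open>Products over multisets of numbers in the unit interval\<close>

lemma prod_mset_unit_interval:
  fixes f :: "'a \<Rightarrow> real"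
  assumes "\<And>k. k \<in># j \<Longrightarrow> f k \<in> {0..1}"
  shows "(\<Prod>k\<in>#j. f k) \<in> {0..1}"
  using assms by (induction j) (auto simp: mult_le_one)

lemma prod_mset_mono:
  fixes f g :: "'a \<Rightarrow> real"
  assumes "\<And>k. k \<in># j \<Longrightarrow> 0 \<le> f k \<and> f k \<le> g k"
  shows "0 \<le> (\<Prod>k\<in>#j. f k) \<and> (\<Prod>k\<in>#j. f k) \<le> (\<Prod>k\<in>#j. g k)"
  using assms by (induction j) (auto intro!: mult_mono intro: order_trans)

lemma abs_diff_prod_mset_le:
  fixes f g :: "'a \<Rightarrow> real"
  assumes "\<And>k. k \<in># j \<Longrightarrow> f k \<in> {0..1} \<and> g k \<in> {0..1}"
  shows "\<bar>(\<Prod>k\<in>#j. f k) - (\<Prod>k\<in>#j. g k)\<bar> \<le> (\<Sum>k\<in>#j. \<bar>f k - g k\<bar>)"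
  using assms
proof (induction j)
  case (add x j)
  let ?F = "\<Prod>k\<in>#j. f k" and ?G = "\<Prod>k\<in>#j. g k"
  have F: "?F \<in> {0..1}"
    by (rule prod_mset_unit_interval) (use add.prems in auto)
  have g: "g x \<in> {0..1}"
    using add.prems by auto
  have IH: "\<bar>?F - ?G\<bar> \<le> (\<Sum>k\<in>#j. \<bar>f k - g k\<bar>)"
    using add by auto
  have "\<bar>f x * ?F - g x * ?G\<bar> = \<bar>(f x - g x) * ?F + g x * (?F - ?G)\<bar>"
    by (simp add: algebra_simps)
  also have "\<dots> \<le> \<bar>f x - g x\<bar> * ?F + g x * \<bar>?F - ?G\<bar>"
    using F g by (intro order_trans[OF abs_triangle_ineq]) (simp add: abs_mult)
  also have "\<dots> \<le> \<bar>f x - g x\<bar> * 1 + 1 * \<bar>?F - ?G\<bar>"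
    using F g by (intro add_mono mult_left_mono mult_right_mono) auto
  finally show ?case
    using IH by simp
qed auto

text \<open>
  While every factor moves linearly from 1, at \<open>t = 0\<close>, to \<open>y k\<close>, at \<open>t = 1\<close>, the product is a convex
  function of \<open>t\<close>; the bound is its chord.
\<close>

lemma prod_mset_convex:
  fixes y :: "'a \<Rightarrow> real"
  assumes "\<And>k. k \<in># j \<Longrightarrow> y k \<in> {0..1}" and t: "t \<in> {0..1}"
  shows "(\<Prod>k\<in>#j. 1 - t * (1 - y k)) \<le> 1 - t * (1 - (\<Prod>k\<in>#j. y k))"
  using assms(1)
proof (induction j)
  case (add x j)
  let ?Y = "\<Prod>k\<in>#j. y k"
  have Y: "?Y \<in> {0..1}"
    by (rule prod_mset_unit_interval) (use add.prems in auto)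
  have x: "y x \<in> {0..1}"
    using add.prems by auto
  have tx: "t * (1 - y x) \<le> 1"
    using t x by (intro mult_le_one) auto
  have "(1 - t * (1 - y x)) * (\<Prod>k\<in>#j. 1 - t * (1 - y k)) \<le> (1 - t * (1 - y x)) * (1 - t * (1 - ?Y))"
    using add tx by (intro mult_left_mono) auto
  also have "\<dots> = 1 - t * (1 - y x * ?Y) - (1 - t) * (t * ((1 - y x) * (1 - ?Y)))"
    by (simp add: algebra_simps)
  also have "\<dots> \<le> 1 - t * (1 - y x * ?Y)"
    using t x Y by simp
  finally show ?case
    by simp
qed auto

lemma sum_mset_delta_0: "(\<Sum>k\<in>#j. if k = 0 then c else 0 :: real) = real (count j 0) * c"
  by (induction j) (auto simp: algebra_simps)

lemma sum_mset_nonneg: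
  fixes d :: "nat \<Rightarrow> real"
  assumes "\<And>k. 0 \<le> d k"
  shows "0 \<le> (\<Sum>k\<in>#j. d k)"
  using assms by (induction j) auto

lemma sum_mset_linear:
  fixes f g :: "nat \<Rightarrow> real"
  shows "c * (a * (\<Sum>k\<in>#j. f k) - (\<Sum>k\<in>#j. g k)) = (\<Sum>k\<in>#j. c * (a * f k - g k))"
proof (induction j)
  case (add x j)
  have "c * (a * (\<Sum>k\<in>#add_mset x j. f k) - (\<Sum>k\<in>#add_mset x j. g k))
      = c * (a * f x - g x) + c * (a * (\<Sum>k\<in>#j. f k) - (\<Sum>k\<in>#j. g k))"
    by (simp add: algebra_simps)
  then show ?case
    by (simp only: add.IH) simp
qed simp

section \<open>Subsequences\<close>

lemma pointwise_convergent_subsequence: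
  fixes z :: "nat \<Rightarrow> nat \<Rightarrow> real"
  assumes "\<And>n k. z n k \<in> {a..b}"
  shows "\<exists>r \<sigma>. strict_mono \<sigma> \<and> (\<forall>k. r k \<in> {a..b} \<and> (\<lambda>n. z (\<sigma> n) k) \<longlonglongrightarrow> r k)"
proof -
  let ?K = "PiE UNIV (\<lambda>_::nat. {a..b})"
  have "compactin (product_topology (\<lambda>_. euclidean) UNIV) ?K"
    by (simp add: compactin_PiE)
  then have "compact ?K"
    unfolding euclidean_product_topology by simp
  then have "seq_compact ?K"
    by (simp add: compact_eq_seq_compact_metric)
  moreover have "\<forall>n. z n \<in> ?K"
    using assms by auto
  ultimately obtain r \<sigma> where r: "r \<in> ?K" "strict_mono \<sigma>" "(z \<circ> \<sigma>) \<longlonglongrightarrow> r"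
    by (rule seq_compactE)
  have "(\<lambda>n. z (\<sigma> n) k) \<longlonglongrightarrow> r k" for k
  proof -
    have "continuous_on UNIV (\<lambda>x :: nat \<Rightarrow> real. x k)"
      by (intro continuous_on_product_coordinates)
    then show ?thesis
      using continuous_on_tendsto_compose[of UNIV "\<lambda>x. x k", OF _ r(3)] by (simp add: o_def)
  qed
  moreover have "r k \<in> {a..b}" for k
    using r(1) by auto
  ultimately show ?thesis
    using r(2) by (intro exI[of _ r] exI[of _ \<sigma>]) simp
qed

text \<open>
  The limit superior of a bounded real sequence, together with a sequence of indices along which it
  is attained.
\<close>

lemma bounded_sequence_sup_limit:
  fixes x :: "nat \<Rightarrow> real"
  assumes "\<And>n. \<bar>x n\<bar> \<le> C"
  shows "\<exists>L \<sigma>. (\<forall>n. n \<le> \<sigma> n) \<and> (\<lambda>n. x (\<sigma> n)) \<longlonglongrightarrow> L \<and> (\<forall>e>0. \<forall>\<^sub>F n in sequentially. x n < L + e)"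
proof -
  define b where "b n = (SUP m\<in>{n..}. x m)" for n
  have bdd: "bdd_above (x ` {n..})" for n
    by (rule bdd_aboveI2[of _ _ C]) (use assms in \<open>simp add: abs_le_iff\<close>)
  have x_le: "x m \<le> b n" if "n \<le> m" for m n
    unfolding b_def by (rule cSUP_upper[OF _ bdd]) (use that in simp)
  have "decseq b"
  proof (rule decseq_SucI)
    show "b (Suc n) \<le> b n" for n
      unfolding b_def by (rule cSUP_subset_mono[OF _ bdd]) auto
  qed
  moreover have "\<forall>n. - C \<le> b n"
    using x_le[of n n for n] assms by (meson abs_le_iff minus_le_iff order.refl order_trans)
  ultimately obtain L where L: "b \<longlonglongrightarrow> L"
    by (rule decseq_convergent)
  have "\<exists>m\<ge>n. b n - inverse (real (Suc n)) < x m" for n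
    using less_cSUP_iff[OF _ bdd, of n "b n - inverse (real (Suc n))"] by (auto simp: b_def)
  then obtain \<sigma> where \<sigma>: "\<forall>n. \<sigma> n \<ge> n \<and> b n - inverse (real (Suc n)) < x (\<sigma> n)"
    by metis
  have "(\<lambda>n. b n - inverse (real (Suc n))) \<longlonglongrightarrow> L"
    using tendsto_diff[OF L LIMSEQ_inverse_real_of_nat] by simp
  then have "(\<lambda>n. x (\<sigma> n)) \<longlonglongrightarrow> L"
    by (rule tendsto_sandwich[OF _ _ _ L, rotated 2])
       (use \<sigma> x_le in \<open>auto intro!: always_eventually less_imp_le\<close>)
  moreover have "\<forall>\<^sub>F n in sequentially. x n < L + e" if "e > 0" for e
  proof -
    have "\<forall>\<^sub>F n in sequentially. b n < L + e"
      by (rule order_tendstoD(2)[OF L]) (use that in simp)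
    then show ?thesis
      by eventually_elim (rule le_less_trans[OF x_le[OF order.refl]])
  qed
  ultimately show ?thesis
    using \<sigma> by (intro exI[of _ L] exI[of _ \<sigma>]) simp
qed

section \<open>The offspring generating function\<close>

lemma gen_fun_shift: "gen_fun P i s = gen_fun P 0 (\<lambda>k. s (i + k))"
  by (simp add: gen_fun_def)

lemma gen_fun_0: "gen_fun P 0 s = measure_pmf.expectation P (\<lambda>j. \<Prod>k\<in>#j. s k)"
  by (simp add: gen_fun_def image_prod_mset_multiplicity)

lemma integrable_prod_mset:
  fixes s :: "nat \<Rightarrow> real"
  assumes "\<And>k. s k \<in> {0..1}"
  shows "integrable (measure_pmf P) (\<lambda>j. \<Prod>k\<in>#j. s k)"
  using prod_mset_unit_interval[of _ s] assms
  by (intro measure_pmf.integrable_const_bound[where B = 1]) auto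

lemma gen_fun_unit_interval:
  assumes "\<And>k. s k \<in> {0..1}"
  shows "gen_fun P 0 s \<in> {0..1}"
proof -
  have *: "(\<Prod>k\<in>#j. s k) \<in> {0..1}" for j
    by (rule prod_mset_unit_interval) (use assms in auto)
  have "gen_fun P 0 s \<le> measure_pmf.expectation P (\<lambda>j. 1)"
    unfolding gen_fun_0 using * by (intro integral_mono integrable_prod_mset assms) auto
  moreover have "0 \<le> gen_fun P 0 s"
    unfolding gen_fun_0 using * by (intro integral_nonneg_AE) auto
  ultimately show ?thesis
    by simp
qed

lemma gen_fun_mono:
  assumes "\<And>k. s k \<in> {0..1}" "\<And>k. t k \<in> {0..1}" "\<And>k. s k \<le> t k"
  shows "gen_fun P 0 s \<le> gen_fun P 0 t"
  unfolding gen_fun_0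
  by (intro integral_mono integrable_prod_mset assms) (use prod_mset_mono[of _ s t] assms in auto)

lemma gen_fun_tendsto:
  assumes "\<And>n k. s n k \<in> {0..1}" "\<And>k. (\<lambda>n. s n k) \<longlonglongrightarrow> t k"
  shows "(\<lambda>n. gen_fun P 0 (s n)) \<longlonglongrightarrow> gen_fun P 0 t"
  unfolding gen_fun_0
proof (rule integral_dominated_convergence[where w = "\<lambda>_. 1"])
  show "AE j in measure_pmf P. (\<lambda>n. \<Prod>k\<in>#j. s n k) \<longlonglongrightarrow> (\<Prod>k\<in>#j. t k)"
  proof (rule AE_I2)
    fix j
    show "(\<lambda>n. \<Prod>k\<in>#j. s n k) \<longlonglongrightarrow> (\<Prod>k\<in>#j. t k)"
      by (induction j) (auto intro!: tendsto_mult assms)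
  qed
  show "AE j in measure_pmf P. norm (\<Prod>k\<in>#j. s n k) \<le> 1" for n
    using prod_mset_unit_interval[of _ "s n"] assms by auto
qed auto

lemma gen_fun_one [simp]: "gen_fun P 0 (\<lambda>_. 1) = 1"
  by (simp add: gen_fun_0)

lemma gen_fun_const: "gen_fun P 0 (\<lambda>_. x) = measure_pmf.expectation P (\<lambda>j. x ^ size j)"
  by (simp add: gen_fun_0)

lemma total_gen_fun_eq:
  assumes "x \<in> {0..1}"
  shows "total_gen_fun P x = gen_fun P 0 (\<lambda>_. x)"
proof -
  have "gen_fun P 0 (\<lambda>_. x) = measure_pmf.expectation (map_pmf size P) (\<lambda>n. x ^ n)"
    by (simp add: gen_fun_const)
  also have "\<dots> = integral\<^sup>L (count_space UNIV) (\<lambda>n. pmf (map_pmf size P) n * x ^ n)"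
    unfolding measure_pmf_eq_density by (subst integral_density) auto
  also have "\<dots> = (\<Sum>n. pmf (map_pmf size P) n * x ^ n)"
  proof (rule integral_count_space_nat)
    have "integrable (measure_pmf (map_pmf size P)) (\<lambda>n. x ^ n)"
      using assms by (intro measure_pmf.integrable_const_bound[where B = 1]) (auto simp: power_le_one)
    then show "integrable (count_space UNIV) (\<lambda>n. pmf (map_pmf size P) n * x ^ n)"
      unfolding measure_pmf_eq_density by (subst (asm) integrable_density) auto
  qed
  also have "\<dots> = total_gen_fun P x"
    by (simp add: total_gen_fun_def pmf_map vimage_def)
  finally show ?thesis
    by simp
qed

section \<open>Probability generating functions of one variable\<close>

text \<open>
  With \<open>\<phi> x = E (1 + x + \<dots> + x\<^bsup>N-1\<^esup>)\<close> one has \<open>1 - E x\<^sup>N = (1 - x) * \<phi> x\<close>, so comparing the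
  generating function \<open>E x\<^sup>N\<close> with \<open>x\<close> amounts to comparing \<open>\<phi> x\<close> with 1.  The function \<open>\<phi>\<close> is
  increasing and continuous up to \<open>x = 1\<close>, where its value is the mean of \<open>N\<close>.
\<close>

definition secant_slope :: "'a pmf \<Rightarrow> ('a \<Rightarrow> nat) \<Rightarrow> real \<Rightarrow> real" where
  "secant_slope P N x = measure_pmf.expectation P (\<lambda>j. \<Sum>l<N j. x ^ l)"

context
  fixes P :: "'a pmf" and N :: "'a \<Rightarrow> nat"
  assumes N: "integrable (measure_pmf P) (\<lambda>j. real (N j))"
begin

lemma geometric_sum_le:
  assumes "x \<in> {0..1::real}"
  shows "0 \<le> (\<Sum>l<n. x ^ l)" "(\<Sum>l<n. x ^ l) \<le> real n"
  using assms sum_bounded_above[of "{..<n}" "\<lambda>l. x ^ l" 1]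
  by (auto intro!: sum_nonneg power_le_one)

lemma integrable_secant_slope:
  assumes x: "x \<in> {0..1::real}"
  shows "integrable (measure_pmf P) (\<lambda>j. \<Sum>l<N j. x ^ l)"
  using geometric_sum_le[OF x] by (intro Bochner_Integration.integrable_bound[OF N]) auto

lemma one_minus_expectation_power:
  assumes "x \<in> {0..1}"
  shows "1 - measure_pmf.expectation P (\<lambda>j. x ^ N j) = (1 - x) * secant_slope P N x"
proof -
  have "integrable (measure_pmf P) (\<lambda>j. x ^ N j)"
    using assms by (intro measure_pmf.integrable_const_bound[where B = 1]) (auto simp: power_le_one)
  then have "1 - measure_pmf.expectation P (\<lambda>j. x ^ N j) = measure_pmf.expectation P (\<lambda>j. 1 - x ^ N j)"
    by simp
  also have "\<dots> = measure_pmf.expectation P (\<lambda>j. (1 - x) * (\<Sum>l<N j. x ^ l))"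
    by (simp add: one_diff_power_eq)
  finally show ?thesis
    by (simp add: secant_slope_def)
qed

lemma secant_slope_one: "secant_slope P N 1 = measure_pmf.expectation P (\<lambda>j. real (N j))"
  by (simp add: secant_slope_def)

lemma continuous_secant_slope: "continuous_on {0..1} (secant_slope P N)"
proof (rule continuous_on_sequentiallyI)
  fix u :: "nat \<Rightarrow> real" and a
  assume u: "\<forall>n. u n \<in> {0..1}" and "u \<longlonglongrightarrow> a"
  then show "(\<lambda>n. secant_slope P N (u n)) \<longlonglongrightarrow> secant_slope P N a"
    unfolding secant_slope_def
    by (intro integral_dominated_convergence[OF _ _ N])
       (use u geometric_sum_le in \<open>auto intro!: tendsto_intros\<close>)
qed

lemma secant_slope_strict_mono:
  assumes "measure_pmf.prob P {j. N j > 1} > 0" "0 \<le> x" "x < y" "y \<le> 1"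
  shows "secant_slope P N x < secant_slope P N y"
proof -
  have le: "(y - x) * indicator {j. N j > 1} j \<le> (\<Sum>l<N j. y ^ l) - (\<Sum>l<N j. x ^ l)" for j
  proof (cases "N j > 1")
    case True
    then obtain n where n: "N j = Suc (Suc n)"
      by (metis less_eqE One_nat_def Suc_leI add_Suc)
    have "(\<Sum>l<n. x ^ Suc (Suc l)) \<le> (\<Sum>l<n. y ^ Suc (Suc l))"
      by (intro sum_mono power_mono) (use assms in auto)
    then show ?thesis
      using True by (simp add: n sum.lessThan_Suc_shift del: sum.lessThan_Suc)
  next
    case False
    then show ?thesis
      using assms by (auto intro!: sum_mono power_mono)
  qed
  have "0 < (y - x) * measure_pmf.prob P {j. N j > 1}"
    using assms by simp
  also have "\<dots> = measure_pmf.expectation P (\<lambda>j. (y - x) * indicator {j. N j > 1} j)"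
    by simp
  also have "\<dots> \<le> measure_pmf.expectation P (\<lambda>j. (\<Sum>l<N j. y ^ l) - (\<Sum>l<N j. x ^ l))"
    using assms by (intro integral_mono le Bochner_Integration.integrable_diff integrable_secant_slope
        integrable_mult_right measure_pmf.integrable_const_bound[where B = 1]) auto
  also have "\<dots> = secant_slope P N y - secant_slope P N x"
    unfolding secant_slope_def
    using assms by (intro Bochner_Integration.integral_diff integrable_secant_slope) auto
  finally show ?thesis
    by simp
qed

lemma expectation_power_le_near_one:
  assumes "measure_pmf.expectation P (\<lambda>j. real (N j)) > 1"
  shows "\<exists>e>0. \<forall>x\<in>{0..1::real}. 1 - x < e \<longrightarrow> measure_pmf.expectation P (\<lambda>j. x ^ N j) \<le> x"
proof -
  let ?d = "secant_slope P N 1 - 1"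
  have "?d > 0"
    using assms by (simp add: secant_slope_one)
  with continuous_secant_slope obtain e where
    e: "e > 0" "\<And>x. x \<in> {0..1} \<Longrightarrow> dist x 1 < e \<Longrightarrow> dist (secant_slope P N x) (secant_slope P N 1) < ?d"
    unfolding continuous_on_iff by (metis atLeastAtMost_iff order.refl zero_le_one)
  have "measure_pmf.expectation P (\<lambda>j. x ^ N j) \<le> x" if x: "x \<in> {0..1}" "1 - x < e" for x
  proof -
    have "dist (secant_slope P N x) (secant_slope P N 1) < ?d"
      using e(2)[of x] x by (simp add: dist_real_def)
    then have "secant_slope P N x \<ge> 1"
      unfolding dist_real_def by linarith
    then have "(1 - x) * 1 \<le> (1 - x) * secant_slope P N x"
      using x by (intro mult_left_mono) auto
    then show ?thesis
      using one_minus_expectation_power[OF x(1)] by simp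
  qed
  then show ?thesis
    using e(1) by (intro exI[of _ e]) auto
qed

end

section \<open>Offspring laws\<close>

locale offspring_law =
  fixes P :: "nat multiset pmf"
  assumes finite_mean: "integrable (measure_pmf P) (\<lambda>j. real (size j))"
    and childless: "pmf P {#} > 0"
    and several_children: "measure_pmf.prob P {j. size j > 1} > 0"
    and same_type_mean: "measure_pmf.expectation P (\<lambda>j. real (count j 0)) < 1"
    and next_type: "measure_pmf.prob P {j. 1 \<in># j} > 0"
begin

abbreviation expect :: "(nat multiset \<Rightarrow> real) \<Rightarrow> real" where
  "expect \<equiv> measure_pmf.expectation P"

abbreviation G :: "(nat \<Rightarrow> real) \<Rightarrow> real" where
  "G \<equiv> gen_fun P 0"

abbreviation total_pgf :: "real \<Rightarrow> real" where
  "total_pgf x \<equiv> gen_fun P 0 (\<lambda>_. x)"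

definition mean :: real where
  "mean = expect (\<lambda>j. real (size j))"

lemma one_minus_total_pgf:
  "x \<in> {0..1} \<Longrightarrow> 1 - total_pgf x = (1 - x) * secant_slope P size x"
  using one_minus_expectation_power[OF finite_mean] by (simp add: gen_fun_const)

lemma total_pgf_0: "total_pgf 0 > 0"
proof -
  have "pmf P {#} = expect (indicator {{#}})"
    by (simp add: measure_pmf_single)
  also have "\<dots> = total_pgf 0"
    unfolding gen_fun_const by (intro Bochner_Integration.integral_cong) (auto simp: indicator_def nonempty_has_size[symmetric])
  finally show ?thesis
    using childless by simp
qed

lemma less_total_pgf:
  assumes "mean \<le> 1" "x \<in> {0..<1}"
  shows "x < total_pgf x"
proof -
  have "secant_slope P size x < secant_slope P size 1"
    using assms by (intro secant_slope_strict_mono finite_mean several_children) auto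
  also have "\<dots> \<le> 1"
    using assms by (simp add: secant_slope_one[OF finite_mean] mean_def)
  finally have slope: "secant_slope P size x < 1" .
  have "1 - total_pgf x = (1 - x) * secant_slope P size x"
    using one_minus_total_pgf assms by simp
  also have "\<dots> < (1 - x) * 1"
    using assms slope by (intro mult_strict_left_mono) auto
  finally show ?thesis
    by simp
qed

lemma integrable_sum_mset:
  assumes "\<And>k. \<bar>h k\<bar> \<le> B"
  shows "integrable (measure_pmf P) (\<lambda>j. \<Sum>k\<in>#j. h k :: real)"
proof (rule Bochner_Integration.integrable_bound)
  show "integrable (measure_pmf P) (\<lambda>j. B * real (size j))"
    by (intro integrable_mult_right finite_mean)
  have *: "\<bar>\<Sum>k\<in>#j. h k\<bar> \<le> B * real (size j)" for j
  proof (induction j)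
    case (add x j)
    then show ?case
      using assms[of x] by (simp add: algebra_simps)
  qed auto
  have "B \<ge> 0"
    using assms[of 0] by linarith
  then show "AE j in measure_pmf P. norm (\<Sum>k\<in>#j. h k) \<le> norm (B * real (size j))"
    using * by (simp add: abs_mult)
qed auto

lemma abs_diff_gen_fun_le:
  assumes "\<And>k. s k \<in> {0..1}" "\<And>k. t k \<in> {0..1}"
  shows "\<bar>G s - G t\<bar> \<le> expect (\<lambda>j. \<Sum>k\<in>#j. \<bar>s k - t k\<bar>)"
proof -
  have "G s - G t = expect (\<lambda>j. (\<Prod>k\<in>#j. s k) - (\<Prod>k\<in>#j. t k))"
    unfolding gen_fun_0 by (intro Bochner_Integration.integral_diff[symmetric] integrable_prod_mset assms)
  also have "\<bar>\<dots>\<bar> \<le> expect (\<lambda>j. \<bar>(\<Prod>k\<in>#j. s k) - (\<Prod>k\<in>#j. t k)\<bar>)"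
    by (rule integral_abs_bound)
  also have "\<dots> \<le> expect (\<lambda>j. \<Sum>k\<in>#j. \<bar>s k - t k\<bar>)"
  proof (intro integral_mono)
    have "\<bar>\<bar>s k - t k\<bar>\<bar> \<le> 1" for k
      using assms[of k] by (simp add: abs_le_iff)
    then show "integrable (measure_pmf P) (\<lambda>j. \<Sum>k\<in>#j. \<bar>s k - t k\<bar>)"
      by (rule integrable_sum_mset)
    show "integrable (measure_pmf P) (\<lambda>j. \<bar>(\<Prod>k\<in>#j. s k) - (\<Prod>k\<in>#j. t k)\<bar>)"
      by (intro integrable_abs Bochner_Integration.integrable_diff integrable_prod_mset assms)
  qed (use assms in \<open>auto intro: abs_diff_prod_mset_le\<close>)
  finally show ?thesis .
qed

text \<open>
  Changing the argument of the generating function at the ancestor's own type changes the value by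
  at most the mean number of children of that type times the change, a factor below 1.  So a
  subsolution cannot exceed a supersolution at a type when it does not exceed it at the higher types.
\<close>

lemma comparison_at_0:
  assumes r: "\<And>k. r k \<in> {0..1}" and g: "\<And>k. g k \<in> {0..1}"
    and le: "\<And>k. k > 0 \<Longrightarrow> r k \<le> g k"
    and sub: "r 0 \<le> G r" and super: "G g \<le> g 0"
  shows "r 0 \<le> g 0"
proof (rule ccontr)
  assume "\<not> r 0 \<le> g 0"
  then have d: "r 0 - g 0 > 0"
    by simp
  let ?h = "g(0 := r 0)"
  have h: "?h k \<in> {0..1}" for k
    using r g by simp
  have "G r \<le> G ?h"
    using le by (intro gen_fun_mono r h) auto
  moreover have "\<bar>G ?h - G g\<bar> \<le> expect (\<lambda>j. \<Sum>k\<in>#j. \<bar>?h k - g k\<bar>)"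
    by (rule abs_diff_gen_fun_le[OF h g])
  moreover have "(\<lambda>k. \<bar>?h k - g k\<bar>) = (\<lambda>k. if k = 0 then r 0 - g 0 else 0)"
    using d by auto
  moreover have "expect (\<lambda>j. real (count j 0) * (r 0 - g 0)) < 1 * (r 0 - g 0)"
    using same_type_mean d by simp
  ultimately show False
    using sub super by (simp add: sum_mset_delta_0)
qed

text \<open>
  Since the generating function at a type involves this and the higher types only, the comparison
  propagates downwards from the types \<open>k \<ge> N\<close>.
\<close>

lemma comparison:
  assumes r: "\<And>k. r k \<in> {0..1}" and g: "\<And>k. g k \<in> {0..1}"
    and above: "\<And>k. k \<ge> N \<Longrightarrow> r k \<le> g k"
    and sub: "\<And>i. i < N \<Longrightarrow> r i \<le> gen_fun P i r"
    and super: "\<And>i. i < N \<Longrightarrow> gen_fun P i g \<le> g i"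
  shows "r i \<le> g i"
proof (induction "N - i" arbitrary: i rule: less_induct)
  case less
  show ?case
  proof (cases "i < N")
    case True
    have "r (i + 0) \<le> g (i + 0)"
    proof (rule comparison_at_0)
      show "r (i + 0) \<le> G (\<lambda>k. r (i + k))" "G (\<lambda>k. g (i + k)) \<le> g (i + 0)"
        using sub[OF True] super[OF True] by (simp_all add: gen_fun_shift[of P i])
      show "r (i + k) \<le> g (i + k)" if "k > 0" for k
        using less[of "i + k"] that True by auto
    qed (use r g in auto)
    then show ?thesis
      by simp
  qed (use above in auto)
qed

section \<open>First passage to a level\<close>

text \<open>
  Freeze every particle that reaches type \<open>N\<close> exactly and discard the particles that jump over
  \<open>N\<close>.  Then \<open>level_pgf s j\<close> is the generating function, at \<open>s\<close>, of the number of frozen particles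
  when the ancestor has type \<open>N - j\<close>; at \<open>s = 0\<close> it is the probability that the type \<open>N\<close> never
  occurs.  A function of the distance \<open>j\<close> becomes a function of the type by \<open>from_level\<close>, with the
  value 1 above the level because discarded particles contribute a factor 1.  In \<open>level_iter s n\<close>
  the particles that are not frozen after \<open>n\<close> generations count with a factor 1; the sequence
  decreases to \<open>level_pgf s\<close>.
\<close>

definition from_level :: "nat \<Rightarrow> (nat \<Rightarrow> real) \<Rightarrow> nat \<Rightarrow> real" where
  "from_level N y i = (if i \<le> N then y (N - i) else 1)"

primrec level_iter :: "real \<Rightarrow> nat \<Rightarrow> nat \<Rightarrow> real" where
  "level_iter s 0 = (\<lambda>j. if j = 0 then s else 1)"
| "level_iter s (Suc n) = (\<lambda>j. if j = 0 then s else G (from_level j (level_iter s n)))"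

definition level_pgf :: "real \<Rightarrow> nat \<Rightarrow> real" where
  "level_pgf s j = lim (\<lambda>n. level_iter s n j)"

lemma from_level_shift: "i \<le> N \<Longrightarrow> from_level N y (i + k) = from_level (N - i) y k"
  by (auto simp: from_level_def)

lemma gen_fun_from_level:
  "gen_fun P i (from_level N y) = (if i \<le> N then G (from_level (N - i) y) else 1)"
proof (cases "i \<le> N")
  case False
  then have "(\<lambda>k. from_level N y (i + k)) = (\<lambda>_. 1)"
    by (auto simp: from_level_def)
  then show ?thesis
    using False by (simp add: gen_fun_shift[of P i])
qed (simp add: gen_fun_shift[of P i] from_level_shift)

lemma from_level_unit_interval: "(\<And>j. y j \<in> {0..1}) \<Longrightarrow> from_level N y i \<in> {0..1}"
  by (auto simp: from_level_def)

lemma level_iter_unit_interval: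
  assumes "s \<in> {0..1}"
  shows "level_iter s n j \<in> {0..1}"
proof (induction n arbitrary: j)
  case (Suc n)
  then have "G (from_level j (level_iter s n)) \<in> {0..1}"
    by (intro gen_fun_unit_interval from_level_unit_interval)
  then show ?case
    using assms by simp
qed (use assms in auto)

lemma level_iter_Suc_le:
  assumes "s \<in> {0..1}"
  shows "level_iter s (Suc n) j \<le> level_iter s n j"
proof (induction n arbitrary: j)
  case 0
  have "G (from_level j (level_iter s 0)) \<in> {0..1}"
    by (intro gen_fun_unit_interval from_level_unit_interval level_iter_unit_interval assms)
  then show ?case
    by simp
next
  case (Suc n)
  have "G (from_level j (level_iter s (Suc n))) \<le> G (from_level j (level_iter s n))"
    by (intro gen_fun_mono from_level_unit_interval level_iter_unit_interval assms)
       (use Suc in \<open>simp add: from_level_def del: level_iter.simps\<close>)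
  then show ?case
    by (cases "j = 0") simp_all
qed

lemma level_iter_tendsto:
  assumes "s \<in> {0..1}"
  shows "(\<lambda>n. level_iter s n j) \<longlonglongrightarrow> level_pgf s j"
proof -
  have "decseq (\<lambda>n. level_iter s n j)"
    by (intro decseq_SucI level_iter_Suc_le assms)
  moreover have "\<forall>n. 0 \<le> level_iter s n j"
    using level_iter_unit_interval[OF assms] by simp
  ultimately obtain L where "(\<lambda>n. level_iter s n j) \<longlonglongrightarrow> L"
    by (rule decseq_convergent)
  then show ?thesis
    by (simp add: level_pgf_def limI)
qed

lemma level_pgf_unit_interval:
  assumes "s \<in> {0..1}"
  shows "level_pgf s j \<in> {0..1}"
  using LIMSEQ_le_const[OF level_iter_tendsto[OF assms], of 0] LIMSEQ_le_const2[OF level_iter_tendsto[OF assms], of _ 1]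
    level_iter_unit_interval[OF assms] by auto

lemma level_pgf_0 [simp]: "level_pgf s 0 = s"
proof -
  have "level_iter s n 0 = s" for n
    by (cases n) auto
  then show ?thesis
    by (simp add: level_pgf_def)
qed

lemma level_pgf_fixed_point:
  assumes "s \<in> {0..1}" "j > 0"
  shows "level_pgf s j = G (from_level j (level_pgf s))"
proof -
  have "(\<lambda>n. G (from_level j (level_iter s n))) \<longlonglongrightarrow> G (from_level j (level_pgf s))"
  proof (rule gen_fun_tendsto)
    show "(\<lambda>n. from_level j (level_iter s n) k) \<longlonglongrightarrow> from_level j (level_pgf s) k" for k
      by (simp add: from_level_def level_iter_tendsto[OF assms(1)])
  qed (intro from_level_unit_interval level_iter_unit_interval assms)
  moreover have "(\<lambda>n. G (from_level j (level_iter s n))) \<longlonglongrightarrow> level_pgf s j"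
    using LIMSEQ_Suc[OF level_iter_tendsto[OF assms(1)], of j] assms(2) by simp
  ultimately show ?thesis
    by (intro LIMSEQ_unique)
qed

lemma level_pgf_1: "level_pgf 1 j = 1"
proof -
  have "level_iter 1 n j = 1" for n j
  proof (induction n arbitrary: j)
    case (Suc n)
    have "from_level j (level_iter 1 n) = (\<lambda>_. 1)"
      by (auto simp: from_level_def Suc)
    then show ?case
      by simp
  qed auto
  then show ?thesis
    by (simp add: level_pgf_def)
qed

text \<open>
  The difference at distance \<open>j\<close> is bounded by the mean sum of the differences at the children.
  The children that keep the distance contribute a fraction below 1 of the left-hand side, which
  can be absorbed, and the others are covered by the induction hypothesis.
\<close>

lemma level_pgf_lipschitz:
  "\<exists>C. \<forall>s\<in>{0..1}. \<forall>t\<in>{0..1}. \<bar>level_pgf s j - level_pgf t j\<bar> \<le> C * \<bar>s - t\<bar>"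
proof (induction j rule: less_induct)
  case (less j)
  show ?case
  proof (cases "j = 0")
    case True
    then show ?thesis
      by (intro exI[of _ 1]) auto
  next
    case False
    have "\<exists>C. \<forall>i<j. \<forall>s\<in>{0..1}. \<forall>t\<in>{0..1}. \<bar>level_pgf s i - level_pgf t i\<bar> \<le> C * \<bar>s - t\<bar>"
    proof -
      obtain c where c: "\<And>i s t. i < j \<Longrightarrow> s \<in> {0..1} \<Longrightarrow> t \<in> {0..1} \<Longrightarrow>
          \<bar>level_pgf s i - level_pgf t i\<bar> \<le> c i * \<bar>s - t\<bar>"
        using less by metis
      have "c i * d \<le> (\<Sum>i<j. \<bar>c i\<bar>) * d" if "i < j" "d \<ge> 0" for i d
        using member_le_sum[of i "{..<j}" "\<lambda>i. \<bar>c i\<bar>"] that by (intro mult_right_mono) auto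
      then have "\<bar>level_pgf s i - level_pgf t i\<bar> \<le> (\<Sum>i<j. \<bar>c i\<bar>) * \<bar>s - t\<bar>"
        if "i < j" "s \<in> {0..1}" "t \<in> {0..1}" for i s t
        using c[OF that] that by (meson abs_ge_zero order_trans)
      then show ?thesis
        by blast
    qed
    then obtain C where C: "\<And>i s t. i < j \<Longrightarrow> s \<in> {0..1} \<Longrightarrow> t \<in> {0..1} \<Longrightarrow>
        \<bar>level_pgf s i - level_pgf t i\<bar> \<le> C * \<bar>s - t\<bar>"
      by blast
    let ?m = "expect (\<lambda>j. real (count j 0))"
    show ?thesis
    proof (intro exI ballI)
      fix s t :: real
      assume st: "s \<in> {0..1}" "t \<in> {0..1}"
      let ?d = "\<bar>level_pgf s j - level_pgf t j\<bar>"
      let ?y = "\<lambda>s. from_level j (level_pgf s)"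
      have y: "?y s k \<in> {0..1}" "?y t k \<in> {0..1}" for k
        by (intro from_level_unit_interval level_pgf_unit_interval st)+
      have C0: "C * \<bar>s - t\<bar> \<ge> 0"
        using C[of 0 s t] st False by simp
      have pt: "\<bar>?y s k - ?y t k\<bar> \<le> (if k = 0 then ?d else 0) + C * \<bar>s - t\<bar>" for k
        using C[of "j - k" s t] st C0 by (auto simp: from_level_def)
      have count: "integrable (measure_pmf P) (\<lambda>J. real (count J 0))"
        by (intro Bochner_Integration.integrable_bound[OF finite_mean]) (auto simp: count_le_size)
      have sum: "(\<Sum>k\<in>#J. (if k = 0 then ?d else 0) + C * \<bar>s - t\<bar>)
          = real (count J 0) * ?d + real (size J) * (C * \<bar>s - t\<bar>)" for J
        by (simp add: sum_mset.distrib sum_mset_delta_0)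
      have "?d = \<bar>G (?y s) - G (?y t)\<bar>"
        using level_pgf_fixed_point st False by simp
      also have "\<dots> \<le> expect (\<lambda>J. \<Sum>k\<in>#J. \<bar>?y s k - ?y t k\<bar>)"
        by (rule abs_diff_gen_fun_le[OF y])
      also have "\<dots> \<le> expect (\<lambda>J. real (count J 0) * ?d + real (size J) * (C * \<bar>s - t\<bar>))"
      proof (rule integral_mono)
        show "integrable (measure_pmf P) (\<lambda>J. \<Sum>k\<in>#J. \<bar>?y s k - ?y t k\<bar>)"
          by (rule integrable_sum_mset[of _ 1]) (use y in \<open>simp add: abs_le_iff, smt (verit, best)\<close>)
        show "integrable (measure_pmf P) (\<lambda>J. real (count J 0) * ?d + real (size J) * (C * \<bar>s - t\<bar>))"
          by (intro Bochner_Integration.integrable_add integrable_mult_left count finite_mean)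
        show "(\<Sum>k\<in>#J. \<bar>?y s k - ?y t k\<bar>) \<le> real (count J 0) * ?d + real (size J) * (C * \<bar>s - t\<bar>)" for J
          unfolding sum[symmetric] by (intro sum_mset_mono pt)
      qed
      also have "\<dots> = ?m * ?d + mean * (C * \<bar>s - t\<bar>)"
        using count finite_mean by (simp add: mean_def)
      finally have "?d * (1 - ?m) \<le> mean * C * \<bar>s - t\<bar>"
        by (simp add: algebra_simps)
      then show "?d \<le> mean * C / (1 - ?m) * \<bar>s - t\<bar>"
        using same_type_mean by (simp add: field_simps)
    qed
  qed
qed

lemma continuous_level_pgf: "continuous_on {0..1} (\<lambda>s. level_pgf s j)"
proof -
  obtain C where C: "\<forall>s\<in>{0..1}. \<forall>t\<in>{0..1}. \<bar>level_pgf s j - level_pgf t j\<bar> \<le> C * \<bar>s - t\<bar>"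
    using level_pgf_lipschitz by blast
  have "\<bar>C\<bar>-lipschitz_on {0..1} (\<lambda>s. level_pgf s j)"
  proof (rule lipschitz_onI)
    fix s t :: real
    assume "s \<in> {0..1}" "t \<in> {0..1}"
    then have "\<bar>level_pgf s j - level_pgf t j\<bar> \<le> C * \<bar>s - t\<bar>"
      using C by blast
    also have "\<dots> \<le> \<bar>C\<bar> * \<bar>s - t\<bar>"
      by (intro mult_right_mono) auto
    finally show "dist (level_pgf s j) (level_pgf t j) \<le> \<bar>C\<bar> * dist s t"
      by (simp add: dist_real_def)
  qed auto
  then show ?thesis
    by (rule lipschitz_on_continuous_on)
qed

text \<open>
  A lower bound that uses a single child of the next type; it transports strict inequalities from
  one type to its neighbour.
\<close>

lemma one_minus_gen_fun_ge:
  assumes "\<And>k. s k \<in> {0..1}"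
  shows "(1 - s 1) * measure_pmf.prob P {j. 1 \<in># j} \<le> 1 - G s"
proof -
  have le: "(\<Prod>k\<in>#j. s k) \<le> 1 - (1 - s 1) * indicator {j. 1 \<in># j} j" for j
  proof (cases "1 \<in># j")
    case True
    then obtain J where J: "j = add_mset 1 J"
      by (metis insert_DiffM)
    have "(\<Prod>k\<in>#J. s k) \<in> {0..1}"
      by (rule prod_mset_unit_interval) (use assms in auto)
    then have "s 1 * (\<Prod>k\<in>#J. s k) \<le> s 1 * 1"
      using assms[of 1] by (intro mult_left_mono) auto
    then show ?thesis
      by (simp add: J)
  next
    case False
    then show ?thesis
      using prod_mset_unit_interval[of j s] assms by simp
  qed
  have "integrable (measure_pmf P) (\<lambda>j. 1 - (1 - s 1) * indicator {j. 1 \<in># j} j)"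
    by (intro Bochner_Integration.integrable_diff integrable_mult_right
        measure_pmf.integrable_const_bound[where B = 1]) auto
  then have "G s \<le> expect (\<lambda>j. 1 - (1 - s 1) * indicator {j. 1 \<in># j} j)"
    unfolding gen_fun_0 by (intro integral_mono integrable_prod_mset assms le)
  also have "\<dots> = 1 - (1 - s 1) * measure_pmf.prob P {j. 1 \<in># j}"
    by (subst Bochner_Integration.integral_diff)
      (auto intro!: measure_pmf.integrable_const_bound[where B = 1] integrable_mult_right)
  finally show ?thesis
    by simp
qed

lemma level_pgf_less_1: "level_pgf 0 j < 1"
proof (induction j)
  case (Suc j)
  have "(1 - from_level (Suc j) (level_pgf 0) 1) * measure_pmf.prob P {j. 1 \<in># j}
      \<le> 1 - G (from_level (Suc j) (level_pgf 0))"
    by (intro one_minus_gen_fun_ge from_level_unit_interval level_pgf_unit_interval) auto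
  moreover have "from_level (Suc j) (level_pgf 0) 1 = level_pgf 0 j"
    by (simp add: from_level_def)
  moreover have "G (from_level (Suc j) (level_pgf 0)) = level_pgf 0 (Suc j)"
    by (intro level_pgf_fixed_point[symmetric]) auto
  ultimately have "(1 - level_pgf 0 j) * measure_pmf.prob P {j. 1 \<in># j} \<le> 1 - level_pgf 0 (Suc j)"
    by simp
  moreover have "(1 - level_pgf 0 j) * measure_pmf.prob P {j. 1 \<in># j} > 0"
    using Suc next_type by simp
  ultimately show ?case
    by linarith
qed auto

end

section \<open>The supercritical case\<close>

locale supercritical_law = offspring_law +
  assumes supercritical: "mean > 1"
begin

text \<open>
  Besides the fixed point property, the choice records the sign of \<open>total_pgf y - y\<close> on both sides of
  the root, which turns sub- and supersolutions into bounds by the root.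
\<close>

definition extinction_root :: real where
  "extinction_root = (SOME x. x \<in> {0<..<1} \<and> total_pgf x = x \<and>
     (\<forall>y. 0 \<le> y \<longrightarrow> y < x \<longrightarrow> y < total_pgf y) \<and> (\<forall>y. x < y \<longrightarrow> y < 1 \<longrightarrow> total_pgf y < y))"

text \<open>
  The function \<open>secant_slope\<close> increases strictly from a value below 1 at 0, as a particle may be
  childless, to the mean at 1; the root is the point where it crosses 1.
\<close>

lemma extinction_root_ex:
  "\<exists>x. x \<in> {0<..<1} \<and> total_pgf x = x \<and>
     (\<forall>y. 0 \<le> y \<longrightarrow> y < x \<longrightarrow> y < total_pgf y) \<and> (\<forall>y. x < y \<longrightarrow> y < 1 \<longrightarrow> total_pgf y < y)"
proof -
  let ?S = "secant_slope P size"
  have pgf: "1 - total_pgf y = (1 - y) * ?S y" if "y \<in> {0..1}" for y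
    using one_minus_total_pgf[OF that] .
  have S0: "?S 0 < 1"
    using pgf[of 0] total_pgf_0 by simp
  moreover have S1: "1 < ?S 1"
    using supercritical by (simp add: secant_slope_one[OF finite_mean] mean_def)
  ultimately have "\<exists>x. 0 \<le> x \<and> x \<le> 1 \<and> ?S x = 1"
    by (intro IVT' continuous_secant_slope finite_mean) simp_all
  then obtain x where x: "0 \<le> x" "x \<le> 1" "?S x = 1"
    by blast
  have "x \<noteq> 0"
    using x(3) S0 by (metis less_irrefl)
  moreover have "x \<noteq> 1"
    using x(3) S1 by (metis less_irrefl)
  ultimately have x01: "x \<in> {0<..<1}"
    using x(1,2) by simp
  have mono: "?S y < ?S z" if "0 \<le> y" "y < z" "z \<le> 1" for y z
    using that by (intro secant_slope_strict_mono finite_mean several_children) auto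
  have below: "y < total_pgf y" if "0 \<le> y" "y < x" for y
  proof -
    have "?S y < ?S x"
      by (rule mono) (use that x in auto)
    then have "(1 - y) * ?S y < (1 - y) * 1"
      unfolding x(3) by (intro mult_strict_left_mono) (use that x in auto)
    moreover have "1 - total_pgf y = (1 - y) * ?S y"
      by (rule pgf) (use that x in auto)
    ultimately have "1 - total_pgf y < 1 - y"
      by (simp only: mult_1_right)
    then show ?thesis
      by simp
  qed
  have above: "total_pgf y < y" if "x < y" "y < 1" for y
  proof -
    have "?S x < ?S y"
      by (rule mono) (use that x in auto)
    then have "(1 - y) * 1 < (1 - y) * ?S y"
      unfolding x(3) by (intro mult_strict_left_mono) (use that x in auto)
    moreover have "1 - total_pgf y = (1 - y) * ?S y"
      by (rule pgf) (use that x in auto)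
    ultimately have "1 - y < 1 - total_pgf y"
      by (simp only: mult_1_right)
    then show ?thesis
      by simp
  qed
  have "total_pgf x = x"
    using pgf[of x] x by simp
  with x01 below above show ?thesis
    by (intro exI[of _ x] conjI allI impI)
qed

lemma extinction_root_bounds: "extinction_root \<in> {0<..<1}"
  and total_pgf_extinction_root: "total_pgf extinction_root = extinction_root"
  and less_total_pgf_below_root: "0 \<le> y \<Longrightarrow> y < extinction_root \<Longrightarrow> y < total_pgf y"
  and total_pgf_less_above_root: "extinction_root < y \<Longrightarrow> y < 1 \<Longrightarrow> total_pgf y < y"
  using someI_ex[OF extinction_root_ex, folded extinction_root_def] by simp_all

lemma extinction_root_unique:
  assumes "x \<in> {0<..<1}" "total_pgf x = x"
  shows "x = extinction_root"
  using less_total_pgf_below_root[of x] total_pgf_less_above_root[of x] assms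
  by (cases x extinction_root rule: linorder_cases) auto

lemma prod_mset_truncated:
  "(\<Prod>k\<in>#j. if k \<le> K then c else 1) = c ^ size {#k \<in># j. k \<le> (K::nat)#}"
  by (induction j) auto

lemma truncated_mean_gt_1:
  "\<exists>K. expect (\<lambda>j. real (size {#k \<in># j. k \<le> K#})) > 1"
proof -
  have "(\<lambda>K. expect (\<lambda>j. real (size {#k \<in># j. k \<le> K#}))) \<longlonglongrightarrow> expect (\<lambda>j. real (size j))"
  proof (rule integral_dominated_convergence[OF _ _ finite_mean])
    show "AE j in measure_pmf P. (\<lambda>K. real (size {#k \<in># j. k \<le> K#})) \<longlonglongrightarrow> real (size j)"
    proof (rule AE_I2)
      fix j :: "nat multiset"
      have "{#k \<in># j. k \<le> K#} = j" if "K \<ge> Max (set_mset j)" for K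
      proof (rule multiset_eqI)
        fix x
        show "count {#k \<in># j. k \<le> K#} x = count j x"
          using that by (cases "x \<in># j") (auto dest!: Max_ge[rotated] simp: not_in_iff)
      qed
      then have "\<forall>\<^sub>F K in sequentially. real (size {#k \<in># j. k \<le> K#}) = real (size j)"
        unfolding eventually_sequentially by metis
      then show "(\<lambda>K. real (size {#k \<in># j. k \<le> K#})) \<longlonglongrightarrow> real (size j)"
        by (rule tendsto_eventually)
    qed
  qed (auto intro: size_filter_mset_lesseq)
  then have "\<forall>\<^sub>F K in sequentially. expect (\<lambda>j. real (size {#k \<in># j. k \<le> K#})) > 1"
    using supercritical unfolding mean_def by (intro order_tendstoD(1))
  then show ?thesis
    unfolding eventually_sequentially by blast
qed

text \<open>
  Every level is reached with probability bounded away from 0.  Children that move at most \<open>K\<close>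
  types up still have mean above 1, so \<open>1 - \<alpha>\<close> is a supersolution for the truncated law; it
  dominates the finitely many distances up to \<open>K\<close> if \<open>\<alpha>\<close> is small.
\<close>

lemma level_pgf_bounded:
  "\<exists>\<alpha>\<in>{0<..1}. \<forall>j. level_pgf 0 j \<le> 1 - \<alpha>"
proof -
  obtain K where K: "expect (\<lambda>j. real (size {#k \<in># j. k \<le> K#})) > 1"
    using truncated_mean_gt_1 by blast
  have "integrable (measure_pmf P) (\<lambda>j. real (size {#k \<in># j. k \<le> K#}))"
    by (intro Bochner_Integration.integrable_bound[OF finite_mean]) (auto intro: size_filter_mset_lesseq)
  from expectation_power_le_near_one[OF this K] obtain e where e: "e > 0"
    "\<And>x. x \<in> {0..1} \<Longrightarrow> 1 - x < e \<Longrightarrow> expect (\<lambda>j. x ^ size {#k \<in># j. k \<le> K#}) \<le> x"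
    by blast
  define a where "a = Min ((\<lambda>j. 1 - level_pgf 0 j) ` {..K})"
  have a: "a > 0" "\<And>j. j \<le> K \<Longrightarrow> a \<le> 1 - level_pgf 0 j"
    unfolding a_def by (auto simp: level_pgf_less_1)
  define \<alpha> where "\<alpha> = min a (e / 2)"
  have \<alpha>: "0 < \<alpha>" "\<alpha> \<le> a" "\<alpha> < e"
    using a(1) e(1) by (auto simp: \<alpha>_def)
  have \<alpha>1: "\<alpha> \<le> 1"
    using a(2)[of 0] \<alpha> by simp
  have "level_pgf 0 j \<le> 1 - \<alpha>" for j
  proof (induction j rule: less_induct)
    case (less j)
    show ?case
    proof (cases "j \<le> K")
      case True
      then show ?thesis
        using a(2)[of j] \<alpha> by linarith
    next
      case False
      let ?g = "\<lambda>k. if k \<le> K then 1 - \<alpha> else 1"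
      have "from_level j (level_pgf 0) 0 \<le> ?g 0"
      proof (rule comparison_at_0)
        show "from_level j (level_pgf 0) k \<in> {0..1}" for k
          by (intro from_level_unit_interval level_pgf_unit_interval) auto
        show "?g k \<in> {0..1}" for k
          using \<alpha> \<alpha>1 by simp
        show "from_level j (level_pgf 0) k \<le> ?g k" if "k > 0" for k
          using less[of "j - k"] that False level_pgf_unit_interval[of 0] by (auto simp: from_level_def)
        show "from_level j (level_pgf 0) 0 \<le> G (from_level j (level_pgf 0))"
          using level_pgf_fixed_point[of 0 j] False by (simp add: from_level_def)
        show "G ?g \<le> ?g 0"
          using e(2)[of "1 - \<alpha>"] \<alpha> \<alpha>1 by (simp add: gen_fun_0 prod_mset_truncated)
      qed
      then show ?thesis
        by (simp add: from_level_def)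
    qed
  qed
  then show ?thesis
    using \<alpha> \<alpha>1 by (intro bexI[of _ \<alpha>]) auto
qed

text \<open>
  The tail suprema of the probabilities of missing a level decrease to a limit \<open>B < 1\<close> with
  \<open>B \<le> total_pgf B\<close>, and such a number does not exceed the extinction root.
\<close>

lemma level_pgf_eventually_less:
  assumes "x > extinction_root"
  shows "\<forall>\<^sub>F j in sequentially. level_pgf 0 j < x"
proof -
  obtain \<alpha> where \<alpha>: "\<alpha> \<in> {0<..1}" "\<And>j. level_pgf 0 j \<le> 1 - \<alpha>"
    using level_pgf_bounded by blast
  define b where "b j = (SUP l\<in>{j..}. level_pgf 0 l)" for j
  have y01: "level_pgf 0 j \<in> {0..1}" for j
    by (rule level_pgf_unit_interval) simp
  have bdd: "bdd_above (level_pgf 0 ` {j..})" for j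
    using \<alpha>(2) by (auto intro!: bdd_aboveI2)
  have y_le_b: "level_pgf 0 l \<le> b j" if "j \<le> l" for j l
    unfolding b_def using that by (intro cSUP_upper bdd) simp
  have b_le: "b j \<le> 1 - \<alpha>" for j
    unfolding b_def by (intro cSUP_least \<alpha>(2)) auto
  have b01: "b j \<in> {0..1}" for j
    using y_le_b[of j j] y01[of j] b_le[of j] \<alpha>(1) by auto
  have b_mono: "b l \<le> b j" if "j \<le> l" for j l
    unfolding b_def using that by (intro cSUP_subset_mono bdd) auto
  have "decseq b"
    by (intro decseq_SucI b_mono) auto
  moreover have "\<forall>j. 0 \<le> b j"
    using b01 by simp
  ultimately obtain B where B: "b \<longlonglongrightarrow> B" and B_le: "\<forall>j. B \<le> b j"
    by (rule decseq_convergent)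
  have "B \<ge> 0"
    using LIMSEQ_le_const[OF B, of 0] b01 by auto
  have "b j \<le> G (from_level j b)" if "j > 0" for j
    unfolding b_def[of j]
  proof (intro cSUP_least)
    fix l assume l: "l \<in> {j..}"
    then have "level_pgf 0 l = G (from_level l (level_pgf 0))"
      using that by (intro level_pgf_fixed_point) auto
    also have "\<dots> \<le> G (from_level j b)"
    proof (intro gen_fun_mono from_level_unit_interval y01 b01)
      show "from_level l (level_pgf 0) k \<le> from_level j b k" for k
        using l y01[of "l - k"] y_le_b[of "j - k" "l - k"] by (auto simp: from_level_def)
    qed
    finally show "level_pgf 0 l \<le> G (from_level j b)" .
  qed auto
  then have le: "B \<le> G (from_level j b)" if "j > 0" for j
    using order_trans[OF B_le[rule_format, of j]] that by simp
  have "(\<lambda>j. G (from_level j b)) \<longlonglongrightarrow> total_pgf B"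
  proof (rule gen_fun_tendsto)
    show "(\<lambda>j. from_level j b k) \<longlonglongrightarrow> B" for k
    proof (rule Lim_transform_eventually)
      show "(\<lambda>j. b (j - k)) \<longlonglongrightarrow> B"
        using filterlim_compose[OF B filterlim_minus_const_nat_at_top] .
      show "\<forall>\<^sub>F j in sequentially. b (j - k) = from_level j b k"
        using eventually_ge_at_top[of k] by eventually_elim (simp add: from_level_def)
    qed
  qed (intro from_level_unit_interval b01)
  then have "B \<le> total_pgf B"
    by (rule LIMSEQ_le_const) (use le in \<open>auto intro!: exI[of _ 1]\<close>)
  moreover have "B < 1"
    using B_le[rule_format, of 0] b_le[of 0] \<alpha>(1) by simp
  ultimately have "B \<le> extinction_root"
    using total_pgf_less_above_root[of B] by (meson not_le)
  then have "\<forall>\<^sub>F j in sequentially. b j < x"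
    using order_tendstoD(2)[OF B] assms by simp
  then show ?thesis
    by eventually_elim (rule le_less_trans[OF y_le_b[OF order.refl]])
qed

section \<open>Infinitely many fixed points\<close>

text \<open>
  For \<open>x\<close> between the extinction root and 1, continuity in the boundary value yields for every
  distant level \<open>N\<close> a solution below \<open>N\<close> with value \<open>x\<close> at the type 0.  A limit of these solutions,
  as \<open>N\<close> grows, solves the fixed point equation at every type.
\<close>

lemma fixed_point_with_initial_value:
  assumes x: "extinction_root < x" "x < 1"
  shows "\<exists>r\<in>fixed_points P. r 0 = x"
proof -
  have "\<forall>\<^sub>F N in sequentially. \<exists>s\<in>{0..1}. level_pgf s N = x"
    using level_pgf_eventually_less[OF x(1)]
  proof eventually_elim
    case (elim N)
    have "\<exists>s. 0 \<le> s \<and> s \<le> 1 \<and> level_pgf s N = x"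
      by (rule IVT'[OF _ _ _ continuous_level_pgf]) (use elim x in \<open>simp_all add: level_pgf_1\<close>)
    then show ?case
      by auto
  qed
  then obtain N0 where N0: "\<forall>N\<ge>N0. \<exists>s. s \<in> {0..1} \<and> level_pgf s N = x"
    unfolding eventually_sequentially Bex_def ..
  define s where "s N = (SOME s. s \<in> {0..1} \<and> level_pgf s N = x)" for N
  have s: "s N \<in> {0..1}" "level_pgf (s N) N = x" if "N \<ge> N0" for N
    using someI_ex[OF N0[rule_format, OF that]] by (simp_all add: s_def)
  define z where "z n = from_level (N0 + n) (level_pgf (s (N0 + n)))" for n
  have z01: "z n k \<in> {0..1}" for n k
    unfolding z_def by (intro from_level_unit_interval level_pgf_unit_interval s) auto
  obtain r where "\<exists>\<sigma>. strict_mono \<sigma> \<and> (\<forall>k. r k \<in> {0..1} \<and> (\<lambda>n. z (\<sigma> n) k) \<longlonglongrightarrow> r k)"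
    using pointwise_convergent_subsequence[of z 0 1, OF z01] ..
  then obtain \<sigma> where \<sigma>: "strict_mono \<sigma> \<and> (\<forall>k. r k \<in> {0..1} \<and> (\<lambda>n. z (\<sigma> n) k) \<longlonglongrightarrow> r k)" ..
  have r: "strict_mono \<sigma>" and r01: "r k \<in> {0..1}" and lim: "(\<lambda>n. z (\<sigma> n) k) \<longlonglongrightarrow> r k" for k
    using \<sigma> by simp_all
  have "gen_fun P i r = r i" for i
  proof (rule LIMSEQ_unique)
    show "(\<lambda>n. gen_fun P i (z (\<sigma> n))) \<longlonglongrightarrow> gen_fun P i r"
      unfolding gen_fun_shift[of P i] by (intro gen_fun_tendsto lim z01)
    show "(\<lambda>n. gen_fun P i (z (\<sigma> n))) \<longlonglongrightarrow> r i"
    proof (rule Lim_transform_eventually[OF lim])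
      show "\<forall>\<^sub>F n in sequentially. z (\<sigma> n) i = gen_fun P i (z (\<sigma> n))"
        using eventually_gt_at_top[of i]
      proof eventually_elim
        case (elim n)
        have "i < N0 + \<sigma> n"
          using strict_mono_imp_increasing[OF r, of n] elim by linarith
        let ?N = "N0 + \<sigma> n"
        have "z (\<sigma> n) i = level_pgf (s ?N) (?N - i)"
          using \<open>i < ?N\<close> by (simp add: z_def from_level_def)
        also have "\<dots> = G (from_level (?N - i) (level_pgf (s ?N)))"
          using \<open>i < ?N\<close> by (intro level_pgf_fixed_point s) auto
        also have "\<dots> = gen_fun P i (z (\<sigma> n))"
          using \<open>i < ?N\<close> by (simp add: z_def gen_fun_from_level[of i])
        finally show ?case .
      qed
    qed
  qed
  moreover have "r 0 = x"
  proof (rule LIMSEQ_unique[OF lim])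
    have "z n 0 = x" for n
      using s(2)[of "N0 + n"] by (simp add: z_def from_level_def)
    then show "(\<lambda>n. z (\<sigma> n) 0) \<longlonglongrightarrow> x"
      by simp
  qed
  ultimately show ?thesis
    using r01 by (intro bexI[of _ r]) (auto simp: fixed_points_def)
qed

lemma infinite_fixed_points: "infinite (fixed_points P)"
proof
  assume "finite (fixed_points P)"
  then have "finite ((\<lambda>r. r 0) ` fixed_points P)"
    by simp
  moreover have "{extinction_root<..<1} \<subseteq> (\<lambda>r. r 0) ` fixed_points P"
    using fixed_point_with_initial_value by force
  ultimately have "finite {extinction_root<..<1}"
    by (rule rev_finite_subset)
  then show False
    using extinction_root_bounds infinite_Ioo[of extinction_root 1] by simp
qed

end

section \<open>Classification of the fixed points\<close>

lemma fixed_pointD: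
  assumes "r \<in> fixed_points P"
  shows "r k \<in> {0..1}" "gen_fun P i r = r i" "gen_fun P 0 (\<lambda>k. r (i + k)) = r i"
  using assms gen_fun_shift[of P i r] by (simp_all add: fixed_points_def)

context offspring_law
begin

text \<open>
  All descendants of a particle of type at least \<open>i\<close> have type at least \<open>i\<close>, so the supremum of a
  fixed point over these types is a subsolution of the total generating function, and the infimum
  is a supersolution.
\<close>

lemma fixed_point_Sup_tail:
  assumes r: "r \<in> fixed_points P"
  shows "(SUP k\<in>{i..}. r k) \<le> total_pgf (SUP k\<in>{i..}. r k)"
    and "(SUP k\<in>{i..}. r k) \<in> {0..1}"
    and "i \<le> k \<Longrightarrow> r k \<le> (SUP k\<in>{i..}. r k)"
proof -
  note r01 = fixed_pointD(1)[OF r]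
  let ?B = "SUP k\<in>{i..}. r k"
  have bdd: "bdd_above (r ` {i..})"
    by (rule bdd_aboveI2[of _ _ 1]) (use r01 in auto)
  have upper: "r k \<le> ?B" if "i \<le> k" for k
    by (rule cSUP_upper[OF _ bdd]) (use that in simp)
  have "?B \<le> 1"
    by (rule cSUP_least) (use r01 in auto)
  moreover have "0 \<le> ?B"
    using upper[of i] r01[of i] by simp
  ultimately show B01: "?B \<in> {0..1}"
    by simp
  show "?B \<le> total_pgf ?B"
  proof (rule cSUP_least)
    fix k assume "k \<in> {i..}"
    then have "G (\<lambda>l. r (k + l)) \<le> total_pgf ?B"
      by (intro gen_fun_mono r01 B01 upper) simp
    then show "r k \<le> total_pgf ?B"
      using fixed_pointD(3)[OF r] by simp
  qed simp
  show "i \<le> k \<Longrightarrow> r k \<le> ?B"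
    by (rule upper)
qed

lemma fixed_point_Inf:
  assumes r: "r \<in> fixed_points P"
  shows "total_pgf (INF k. r k) \<le> (INF k. r k)" "(INF k. r k) \<in> {0..1}" "(INF k. r k) \<le> r k"
proof -
  note r01 = fixed_pointD(1)[OF r]
  let ?I = "INF k. r k"
  have bdd: "bdd_below (range r)"
    by (rule bdd_belowI2[of _ 0]) (use r01 in auto)
  have lower: "?I \<le> r k" for k
    by (rule cINF_lower[OF bdd]) simp
  have "0 \<le> ?I"
    by (rule cINF_greatest) (use r01 in auto)
  moreover have "?I \<le> 1"
    using lower[of 0] r01[of 0] by simp
  ultimately show I01: "?I \<in> {0..1}"
    by simp
  show "total_pgf ?I \<le> ?I"
  proof (rule cINF_greatest)
    fix k
    have "total_pgf ?I \<le> G (\<lambda>l. r (k + l))"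
      by (intro gen_fun_mono r01 I01 lower)
    then show "total_pgf ?I \<le> r k"
      using fixed_pointD(3)[OF r] by simp
  qed simp
  show "?I \<le> r k"
    by (rule lower)
qed

lemma const_fixed_point:
  assumes "x \<in> {0..1}" "total_pgf x = x"
  shows "(\<lambda>_. x) \<in> fixed_points P"
  using assms gen_fun_shift[of P _ "\<lambda>_. x"] by (simp add: fixed_points_def)

lemma fixed_points_subcritical:
  assumes "mean \<le> 1"
  shows "fixed_points P = {\<lambda>_. 1}"
proof
  show "{\<lambda>_. 1} \<subseteq> fixed_points P"
    using const_fixed_point[of 1] by simp
  show "fixed_points P \<subseteq> {\<lambda>_. 1}"
  proof
    fix r assume r: "r \<in> fixed_points P"
    have "\<not> (INF k. r k) < 1"
      using less_total_pgf[OF assms, of "INF k. r k"] fixed_point_Inf(1,2)[OF r] by auto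
    then have "r k = 1" for k
      using fixed_point_Inf(3)[OF r, of k] fixed_pointD(1)[OF r, of k] by auto
    then show "r \<in> {\<lambda>_. 1}"
      by auto
  qed
qed

lemma fixed_point_eqI:
  assumes r: "r \<in> fixed_points P" and g: "g \<in> fixed_points P"
    and eq: "\<And>k. k \<ge> N \<Longrightarrow> r k = g k"
  shows "r = g"
proof
  fix k
  have "r k \<le> g k" "g k \<le> r k"
    by (rule comparison[of _ _ N]; use fixed_pointD[OF r] fixed_pointD[OF g] eq in auto)+
  then show "r k = g k"
    by simp
qed

text \<open>
  The value 1 is inherited by the next type, and two fixed points that agree at all high types are
  equal.
\<close>

lemma fixed_point_less_1:
  assumes r: "r \<in> fixed_points P" and ne: "r \<noteq> (\<lambda>_. 1)"
  shows "r i < 1"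
proof (rule ccontr)
  assume "\<not> r i < 1"
  then have i: "r i = 1"
    using fixed_pointD(1)[OF r, of i] by auto
  have "r (i + n) = 1" for n
  proof (induction n)
    case (Suc n)
    have "(1 - r (i + n + 1)) * measure_pmf.prob P {j. 1 \<in># j} \<le> 1 - G (\<lambda>k. r (i + n + k))"
      by (rule one_minus_gen_fun_ge) (use fixed_pointD(1)[OF r] in simp)
    then have "(1 - r (i + n + 1)) * measure_pmf.prob P {j. 1 \<in># j} \<le> 0"
      using fixed_pointD(3)[OF r, of "i + n"] Suc by simp
    then have "1 - r (i + n + 1) \<le> 0"
      using next_type by (simp add: mult_le_0_iff)
    then show ?case
      using fixed_pointD(1)[OF r, of "i + n + 1"] by simp
  qed (use i in simp)
  then have "r k = 1" if "k \<ge> i" for k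
    using that by (metis le_add_diff_inverse)
  then have "r = (\<lambda>_. 1)"
    by (intro fixed_point_eqI[OF r const_fixed_point]) auto
  then show False
    using ne by simp
qed

section \<open>Harmonic functions of the mean offspring\<close>

text \<open>
  The analogue for means of the lower bound by a single child of the next type.
\<close>

lemma expect_sum_ge_next_type:
  assumes "\<And>k. 0 \<le> d k" "\<And>k. d k \<le> C"
  shows "measure_pmf.prob P {j. 1 \<in># j} * d 1 \<le> expect (\<lambda>j. \<Sum>k\<in>#j. d k)"
proof -
  have le: "indicator {j. 1 \<in># j} j * d 1 \<le> (\<Sum>k\<in>#j. d k)" for j
  proof (cases "1 \<in># j")
    case True
    then obtain J where "j = add_mset 1 J"
      by (metis insert_DiffM)
    moreover have "0 \<le> (\<Sum>k\<in>#J. d k)"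
      using assms(1) by (rule sum_mset_nonneg)
    ultimately show ?thesis
      by simp
  qed (use sum_mset_nonneg[OF assms(1)] in simp)
  have "measure_pmf.prob P {j. 1 \<in># j} * d 1 = expect (\<lambda>j. indicator {j. 1 \<in># j} j * d 1)"
    by simp
  also have "\<dots> \<le> expect (\<lambda>j. \<Sum>k\<in>#j. d k)"
  proof (rule integral_mono[OF _ _ le])
    show "integrable (measure_pmf P) (\<lambda>j. indicator {j. 1 \<in># j} j * d 1)"
      by (intro integrable_mult_left measure_pmf.integrable_const_bound[where B = 1]) auto
    show "integrable (measure_pmf P) (\<lambda>j. \<Sum>k\<in>#j. d k)"
      by (rule integrable_sum_mset[of d C]) (use assms in simp)
  qed
  finally show ?thesis .
qed

text \<open>
  Replacing products by sums in the fixed point equation for \<open>r\<close> gives the linear equation for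
  \<open>w = 1 - r\<close> near 0.
\<close>

definition harmonic :: "(nat \<Rightarrow> real) \<Rightarrow> bool" where
  "harmonic w \<longleftrightarrow> (\<forall>i. w i = expect (\<lambda>j. \<Sum>k\<in>#j. w (i + k)))"

text \<open>
  A maximum principle.  If the ratio of consecutive values is extremal at the start, then the
  nonnegative harmonic function \<open>\<lambda> * w k - w (k + 1)\<close>, or its negative, vanishes there; as children
  move one type up with positive probability, it vanishes everywhere and \<open>w\<close> is geometric.
\<close>

lemma harmonic_extremal_ratio:
  assumes w: "harmonic w" "\<And>k. 0 \<le> w k" "\<And>k. w k \<le> C" and w0: "w 0 = 1"
    and c: "c \<in> {1, -1}" and ratio: "\<And>k. 0 \<le> c * (w 1 * w k - w (Suc k))"
  shows "w k = w 1 ^ k"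
proof -
  let ?d = "\<lambda>k. c * (w 1 * w k - w (Suc k))"
  have int: "integrable (measure_pmf P) (\<lambda>j. \<Sum>k\<in>#j. w (i + k))" for i
    by (rule integrable_sum_mset[of _ C]) (use w in simp)
  have d: "?d i = expect (\<lambda>j. \<Sum>k\<in>#j. ?d (i + k))" for i
  proof -
    have wi: "w i = expect (\<lambda>j. \<Sum>k\<in>#j. w (i + k))" for i
      using w(1) unfolding harmonic_def by (rule spec)
    have "?d i = c * (w 1 * expect (\<lambda>j. \<Sum>k\<in>#j. w (i + k)) - expect (\<lambda>j. \<Sum>k\<in>#j. w (Suc i + k)))"
      using wi[of i] wi[of "Suc i"] by metis
    also have "\<dots> = expect (\<lambda>j. c * (w 1 * (\<Sum>k\<in>#j. w (i + k)) - (\<Sum>k\<in>#j. w (Suc i + k))))"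
      by (simp only: integral_mult_right_zero
          Bochner_Integration.integral_diff[OF integrable_mult_right[OF int] int])
    also have "\<dots> = expect (\<lambda>j. \<Sum>k\<in>#j. ?d (i + k))"
    proof (intro Bochner_Integration.integral_cong refl)
      fix j :: "nat multiset"
      show "c * (w 1 * (\<Sum>k\<in>#j. w (i + k)) - (\<Sum>k\<in>#j. w (Suc i + k))) = (\<Sum>k\<in>#j. ?d (i + k))"
        unfolding add_Suc by (rule sum_mset_linear)
    qed
    finally show ?thesis .
  qed
  have d_le: "?d k \<le> C * C + C" for k
  proof -
    have "w 1 * w k \<le> C * C"
      by (intro mult_mono w order_trans[OF w(2) w(3)])
    moreover have "0 \<le> w 1 * w k"
      by (intro mult_nonneg_nonneg w)
    ultimately show ?thesis
      using c w(2)[of "Suc k"] w(3)[of "Suc k"] by (auto simp: algebra_simps)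
  qed
  have zero: "?d n = 0" for n
  proof (induction n)
    case 0
    then show ?case
      by (simp add: w0)
  next
    case (Suc n)
    have "measure_pmf.prob P {j. 1 \<in># j} * ?d (n + 1) \<le> expect (\<lambda>j. \<Sum>k\<in>#j. ?d (n + k))"
      by (rule expect_sum_ge_next_type[of "\<lambda>k. ?d (n + k)" "C * C + C"]) (use ratio d_le in blast)+
    also have "\<dots> = 0"
      using d[of n] Suc by (simp only:)
    finally have "?d (Suc n) \<le> 0"
      using next_type by (simp add: mult_le_0_iff)
    then show ?case
      using ratio[of "Suc n"] by linarith
  qed
  show ?thesis
  proof (induction k)
    case (Suc k)
    have "c \<noteq> 0"
      using c by auto
    then show ?case
      using zero[of k] Suc by simp
  qed (simp add: w0)
qed

text \<open>
  With \<open>m\<^sub>k\<close> the mean number of children that are \<open>k\<close> types up, the expectation is the sum of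
  \<open>m\<^sub>k * x\<^sup>k\<close> over all \<open>k\<close>.  The roots are the ratios of the geometric harmonic functions.
\<close>

definition characteristic_root :: "real \<Rightarrow> bool" where
  "characteristic_root x \<longleftrightarrow> expect (\<lambda>j. \<Sum>k\<in>#j. x ^ k) = 1"

lemma characteristic_root_unique:
  assumes x: "characteristic_root x" "x \<in> {0<..<1}" and y: "characteristic_root y" "y \<in> {0<..<1}"
  shows "x = y"
proof -
  have *: "\<not> x < y" if x: "characteristic_root x" "x \<in> {0<..<1}"
    and y: "characteristic_root y" "y \<in> {0<..<1}" for x y
  proof
    assume "x < y"
    let ?d = "\<lambda>k. y ^ k - x ^ k"
    have d0: "0 \<le> ?d k" for k
      using power_mono[of x y k] \<open>x < y\<close> x by simp
    have d1: "?d k \<le> 1" for k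
      using power_le_one[of y k] zero_le_power[of x k] x y by (smt (verit) greaterThanLessThan_iff)
    have int: "integrable (measure_pmf P) (\<lambda>j. \<Sum>k\<in>#j. z ^ k)" if "z \<in> {0<..<1}" for z :: real
      by (rule integrable_sum_mset[of _ 1]) (use that in \<open>simp add: power_le_one\<close>)
    have "measure_pmf.prob P {j. 1 \<in># j} * ?d 1 \<le> expect (\<lambda>j. \<Sum>k\<in>#j. ?d k)"
      by (rule expect_sum_ge_next_type[OF d0 d1])
    also have "\<dots> = expect (\<lambda>j. (\<Sum>k\<in>#j. y ^ k) - (\<Sum>k\<in>#j. x ^ k))"
    proof (intro Bochner_Integration.integral_cong refl)
      fix j :: "nat multiset"
      show "(\<Sum>k\<in>#j. ?d k) = (\<Sum>k\<in>#j. y ^ k) - (\<Sum>k\<in>#j. x ^ k)"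
        by (induction j) auto
    qed
    also have "\<dots> = 0"
      using int[OF x(2)] int[OF y(2)] x(1) y(1) by (simp add: characteristic_root_def)
    finally show False
      using next_type \<open>x < y\<close> by (simp add: mult_le_0_iff)
  qed
  show ?thesis
    using *[OF x y] *[OF y x] by simp
qed

end

text \<open>
  At 0 the expectation is the mean number of children of the ancestor's type, which is below 1, and
  from 1 on it is at least the total mean, which is above 1.  The bound on the powers keeps the
  expectation finite, as an integral that does not exist would have the value 0.
\<close>

lemma (in supercritical_law) characteristic_root_bounds:
  assumes root: "characteristic_root x" and "0 \<le> x" and bound: "\<And>k. x ^ k \<le> C"
  shows "x \<in> {0<..<1}"
proof -
  have "x \<noteq> 0"
  proof
    assume "x = 0"
    then have "(\<Sum>k\<in>#j. x ^ k) = real (count j 0)" for j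
      by (induction j) auto
    then show False
      using root same_type_mean by (simp add: characteristic_root_def)
  qed
  moreover have "x < 1"
  proof (rule ccontr)
    assume "\<not> x < 1"
    then have "1 \<le> x"
      by simp
    have "mean \<le> expect (\<lambda>j. \<Sum>k\<in>#j. x ^ k)"
      unfolding mean_def
    proof (rule integral_mono[OF finite_mean])
      show "integrable (measure_pmf P) (\<lambda>j. \<Sum>k\<in>#j. x ^ k)"
        by (rule integrable_sum_mset[of _ C]) (use bound \<open>1 \<le> x\<close> in simp)
      show "real (size j) \<le> (\<Sum>k\<in>#j. x ^ k)" for j
      proof (induction j)
        case (add k j)
        then show ?case
          using one_le_power[OF \<open>1 \<le> x\<close>, of k] by simp
      qed simp
    qed
    then show False
      using root supercritical by (simp add: characteristic_root_def)
  qed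
  ultimately show ?thesis
    using \<open>0 \<le> x\<close> by simp
qed

context supercritical_law
begin

section \<open>Asymptotics of the nonconstant fixed points\<close>

text \<open>
  If \<open>1 - r k\<close> is read as a survival probability of a particle of type \<open>k\<close>, the reason is that a
  particle of type \<open>i\<close> has a descendant of type \<open>N\<close> with probability at least \<open>\<alpha>\<close>, and the survival
  of this descendant suffices.  Analytically, \<open>1 - (1 - r N) * (1 - y)\<close> with the level generating
  function \<open>y\<close> at 0 is a supersolution below \<open>N\<close>, by the chord bound for products.
\<close>

lemma fixed_point_quasi_decreasing:
  assumes r: "r \<in> fixed_points P" and \<alpha>: "\<And>j. level_pgf 0 j \<le> 1 - \<alpha>" and "i \<le> N"
  shows "\<alpha> * (1 - r N) \<le> 1 - r i"
proof -
  note r01 = fixed_pointD(1)[OF r]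
  let ?t = "1 - r N"
  let ?y = "from_level N (level_pgf 0)"
  let ?g = "\<lambda>k. 1 - ?t * (1 - ?y k)"
  have y01: "?y k \<in> {0..1}" for k
    by (intro from_level_unit_interval level_pgf_unit_interval) simp
  have t01: "?t \<in> {0..1}"
    using r01[of N] by simp
  have g01: "?g k \<in> {0..1}" for k
    using y01[of k] t01 by (auto intro!: mult_le_one)
  have "r i \<le> ?g i"
  proof (rule comparison[of r ?g N])
    show "r k \<le> ?g k" if "N \<le> k" for k
      using that r01[of k] by (cases "k = N") (simp_all add: from_level_def)
    show "r k \<le> gen_fun P k r" for k
      using fixed_pointD(2)[OF r, of k] by simp
    fix k assume k: "k < N"
    have Y: "G (\<lambda>l. ?y (k + l)) = ?y k"
    proof -
      have "?y k = G (from_level (N - k) (level_pgf 0))"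
        using k level_pgf_fixed_point[of 0 "N - k"] by (simp add: from_level_def)
      then show ?thesis
        using k by (simp add: from_level_shift)
    qed
    have int: "integrable (measure_pmf P) (\<lambda>j. \<Prod>l\<in>#j. ?y (k + l))"
      by (rule integrable_prod_mset) (rule y01)
    have "gen_fun P k ?g = expect (\<lambda>j. \<Prod>l\<in>#j. ?g (k + l))"
      by (simp only: gen_fun_shift[of P k] gen_fun_0)
    also have "\<dots> \<le> expect (\<lambda>j. 1 - ?t * (1 - (\<Prod>l\<in>#j. ?y (k + l))))"
    proof (rule integral_mono)
      show "integrable (measure_pmf P) (\<lambda>j. \<Prod>l\<in>#j. ?g (k + l))"
        by (rule integrable_prod_mset) (rule g01)
      show "integrable (measure_pmf P) (\<lambda>j. 1 - ?t * (1 - (\<Prod>l\<in>#j. ?y (k + l))))"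
        by (intro Bochner_Integration.integrable_diff integrable_mult_right int) simp_all
      show "(\<Prod>l\<in>#j. ?g (k + l)) \<le> 1 - ?t * (1 - (\<Prod>l\<in>#j. ?y (k + l)))" for j
        by (rule prod_mset_convex[OF y01 t01])
    qed
    also have "\<dots> = 1 - ?t * (1 - G (\<lambda>l. ?y (k + l)))"
      unfolding gen_fun_0 using int by simp
    finally show "gen_fun P k ?g \<le> ?g k"
      by (simp only: Y)
  qed (rule r01 g01)+
  moreover have "?t * \<alpha> \<le> ?t * (1 - ?y i)"
    by (rule mult_left_mono) (use \<alpha>[of "N - i"] t01 \<open>i \<le> N\<close> in \<open>simp_all add: from_level_def\<close>)
  ultimately show ?thesis
    by (simp add: mult.commute)
qed

text \<open>
  A tail supremum \<open>B\<close> of \<open>r\<close> satisfies \<open>B \<le> total_pgf B\<close>, so it is 1 or at most the extinction root; in the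
  latter case \<open>r\<close> is constant on the tail, and then everywhere.  Hence \<open>r\<close> comes arbitrarily close
  to 1, and quasi-monotonicity keeps it there.
\<close>

lemma fixed_point_tendsto_1:
  assumes r: "r \<in> fixed_points P" and ne: "r \<noteq> (\<lambda>_. extinction_root)" and \<alpha>: "\<alpha> > 0"
    "\<And>j. level_pgf 0 j \<le> 1 - \<alpha>"
  shows "r \<longlonglongrightarrow> 1"
proof -
  note r01 = fixed_pointD(1)[OF r]
  have Inf: "extinction_root \<le> (INF k. r k)"
    using less_total_pgf_below_root[of "INF k. r k"] fixed_point_Inf(1,2)[OF r] by fastforce
  have Sup: "(SUP k\<in>{i..}. r k) = 1" for i
  proof (rule ccontr)
    let ?B = "SUP k\<in>{i..}. r k"
    assume "?B \<noteq> 1"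
    then have "?B \<le> extinction_root"
      using total_pgf_less_above_root[of ?B] fixed_point_Sup_tail(1,2)[OF r, of i] by fastforce
    then have "r k = extinction_root" if "k \<ge> i" for k
      using fixed_point_Sup_tail(3)[OF r that] fixed_point_Inf(3)[OF r, of k] Inf by linarith
    then have "r = (\<lambda>_. extinction_root)"
      using extinction_root_bounds total_pgf_extinction_root
      by (intro fixed_point_eqI[OF r const_fixed_point, of _ i]) auto
    then show False
      using ne by simp
  qed
  show ?thesis
  proof (rule LIMSEQ_I)
    fix e :: real assume "e > 0"
    then have "1 - \<alpha> * e < (SUP k\<in>{0..}. r k)"
      using \<alpha> Sup[of 0] by simp
    moreover have "bdd_above (r ` {0..})"
      by (rule bdd_aboveI2[of _ _ 1]) (use r01 in auto)
    ultimately obtain n where n: "1 - \<alpha> * e < r n"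
      using less_cSUP_iff[of "{0..}" r "1 - \<alpha> * e"] by auto
    have "norm (r k - 1) < e" if "k \<ge> n" for k
    proof -
      have "\<alpha> * (1 - r k) \<le> 1 - r n"
        by (rule fixed_point_quasi_decreasing[OF r \<alpha>(2) that])
      also have "\<dots> < \<alpha> * e"
        using n by simp
      finally have "1 - r k < e"
        using \<alpha>(1) by simp
      then show ?thesis
        using r01[of k] by simp
    qed
    then show "\<exists>n. \<forall>k\<ge>n. norm (r k - 1) < e"
      by blast
  qed
qed

end

context supercritical_law
begin

text \<open>
  Along a subsequence of starting types on which the rescaled survival probabilities converge, the
  products linearise and the limit is harmonic.  The quasi-monotonicity supplies the dominating
  function \<open>size / \<alpha>\<close>.
\<close>

lemma rescaled_limit_harmonic:
  assumes r: "r \<in> fixed_points P" and less: "\<And>i. r i < 1" and lim: "r \<longlonglongrightarrow> 1"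
    and \<alpha>: "\<alpha> > 0" "\<And>j. level_pgf 0 j \<le> 1 - \<alpha>"
    and \<sigma>: "filterlim \<sigma> sequentially sequentially"
    and w: "\<And>k. (\<lambda>n. (1 - r (\<sigma> n + k)) / (1 - r (\<sigma> n))) \<longlonglongrightarrow> w k"
  shows "harmonic w"
  unfolding harmonic_def
proof
  fix i
  note r01 = fixed_pointD(1)[OF r]
  let ?U = "\<lambda>n. 1 - r (\<sigma> n)"
  let ?Q = "\<lambda>n j. \<Prod>k\<in>#j. r (\<sigma> n + i + k)"
  have U: "?U n > 0" for n
    using less[of "\<sigma> n"] by simp
  have Q01: "?Q n j \<in> {0..1}" for n j
    by (rule prod_mset_unit_interval) (rule r01)
  have bound: "1 - ?Q n j \<le> real (size j) * (?U n / \<alpha>)" for n j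
  proof (induction j)
    case (add x j)
    let ?a = "r (\<sigma> n + i + x)"
    have "1 - ?a * ?Q n j = (1 - ?a) + ?a * (1 - ?Q n j)"
      by (simp add: algebra_simps)
    also have "\<dots> \<le> (1 - ?a) + 1 * (1 - ?Q n j)"
      using r01[of "\<sigma> n + i + x"] Q01[of n j] by (intro add_left_mono mult_right_mono) simp_all
    also have "1 - ?a \<le> ?U n / \<alpha>"
      using fixed_point_quasi_decreasing[OF r \<alpha>(2), of "\<sigma> n" "\<sigma> n + i + x"] \<alpha>(1)
      by (simp add: field_simps)
    finally have "1 - ?a * ?Q n j \<le> ?U n / \<alpha> + 1 * (1 - ?Q n j)"
      by simp
    then show ?case
      using add by (simp add: distrib_right add_divide_distrib)
  qed simp
  have "(\<lambda>n. expect (\<lambda>j. (1 - ?Q n j) / ?U n)) \<longlonglongrightarrow> expect (\<lambda>j. \<Sum>k\<in>#j. w (i + k))"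
  proof (rule integral_dominated_convergence[where w = "\<lambda>j. real (size j) * (1 / \<alpha>)"])
    show "integrable (measure_pmf P) (\<lambda>j. real (size j) * (1 / \<alpha>))"
      by (intro integrable_mult_left finite_mean)
    show "AE j in measure_pmf P. (\<lambda>n. (1 - ?Q n j) / ?U n) \<longlonglongrightarrow> (\<Sum>k\<in>#j. w (i + k))"
    proof (rule AE_I2)
      fix j
      show "(\<lambda>n. (1 - ?Q n j) / ?U n) \<longlonglongrightarrow> (\<Sum>k\<in>#j. w (i + k))"
      proof (induction j)
        case (add x j)
        have "(\<lambda>n. r (\<sigma> n + (i + x))) \<longlonglongrightarrow> 1"
          by (rule filterlim_compose[OF LIMSEQ_ignore_initial_segment[OF lim] \<sigma>])
        then have "(\<lambda>n. (1 - r (\<sigma> n + (i + x))) / ?U n + r (\<sigma> n + (i + x)) * ((1 - ?Q n j) / ?U n))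
            \<longlonglongrightarrow> w (i + x) + 1 * (\<Sum>k\<in>#j. w (i + k))"
          by (intro tendsto_add tendsto_mult w add)
        moreover have "(1 - r (\<sigma> n + (i + x))) / ?U n + r (\<sigma> n + (i + x)) * ((1 - ?Q n j) / ?U n)
            = (1 - ?Q n (add_mset x j)) / ?U n" for n
          using U[of n] by (simp add: field_simps)
        ultimately show ?case
          by simp
      qed simp
    qed
    show "AE j in measure_pmf P. norm ((1 - ?Q n j) / ?U n) \<le> real (size j) * (1 / \<alpha>)" for n
    proof (rule AE_I2)
      fix j
      have "norm ((1 - ?Q n j) / ?U n) = (1 - ?Q n j) / ?U n"
        using Q01[of n j] U[of n] by simp
      also have "\<dots> \<le> real (size j) * (?U n / \<alpha>) / ?U n"
        using bound[of n j] U[of n] by (intro divide_right_mono) simp_all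
      finally show "norm ((1 - ?Q n j) / ?U n) \<le> real (size j) * (1 / \<alpha>)"
        using U[of n] by simp
    qed
  qed auto
  moreover have "expect (\<lambda>j. (1 - ?Q n j) / ?U n) = (1 - r (\<sigma> n + i)) / ?U n" for n
  proof -
    have "integrable (measure_pmf P) (\<lambda>j. ?Q n j)"
      by (rule integrable_prod_mset) (rule r01)
    then have "expect (\<lambda>j. (1 - ?Q n j) / ?U n) = (1 - expect (\<lambda>j. ?Q n j)) / ?U n"
      by simp
    also have "expect (\<lambda>j. ?Q n j) = r (\<sigma> n + i)"
      using fixed_pointD(3)[OF r, of "\<sigma> n + i"] by (simp add: gen_fun_0)
    finally show ?thesis .
  qed
  ultimately have "(\<lambda>n. (1 - r (\<sigma> n + i)) / ?U n) \<longlonglongrightarrow> expect (\<lambda>j. \<Sum>k\<in>#j. w (i + k))"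
    by (simp only:)
  then show "w i = expect (\<lambda>j. \<Sum>k\<in>#j. w (i + k))"
    by (rule LIMSEQ_unique[OF w])
qed

text \<open>
  For \<open>c = 1\<close> the number \<open>\<gamma>\<close> is the limit superior of the ratios, for \<open>c = -1\<close> it is the limit
  inferior.  Along starting types whose first ratio tends to the extremal value, a rescaled limit
  \<open>w\<close> has \<open>w 0 = 1\<close> and first ratio \<open>\<gamma>\<close>, and none of its later ratios is more extreme; by the
  maximum principle \<open>w\<close> is geometric.
\<close>

lemma extremal_ratio_is_root:
  assumes r: "r \<in> fixed_points P" and less: "\<And>i. r i < 1" and lim: "r \<longlonglongrightarrow> 1"
    and \<alpha>: "\<alpha> > 0" "\<And>j. level_pgf 0 j \<le> 1 - \<alpha>" and c: "c \<in> {1, -1 :: real}"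
  shows "\<exists>\<gamma>\<in>{0<..<1}. characteristic_root \<gamma> \<and>
    (\<forall>e>0. \<forall>\<^sub>F n in sequentially. c * ((1 - r (n + 1)) / (1 - r n)) < c * \<gamma> + e)"
proof -
  let ?\<rho> = "\<lambda>n. (1 - r (n + 1)) / (1 - r n)"
  have ratio: "(1 - r (n + k)) / (1 - r n) \<in> {0..1 / \<alpha>}" for n k
    using fixed_point_quasi_decreasing[OF r \<alpha>(2), of n "n + k"] \<alpha>(1) less[of n] less[of "n + k"]
    by (simp add: field_simps)
  have "\<bar>c * ?\<rho> n\<bar> \<le> 1 / \<alpha>" for n
  proof -
    have "\<bar>c\<bar> = 1"
      using c by auto
    then show ?thesis
      using ratio[of n 1] by (simp only: abs_mult mult_1 abs_of_nonneg atLeastAtMost_iff)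
  qed
  then obtain L where "\<exists>\<sigma>. (\<forall>n. n \<le> \<sigma> n) \<and> (\<lambda>n. c * ?\<rho> (\<sigma> n)) \<longlonglongrightarrow> L \<and>
      (\<forall>e>0. \<forall>\<^sub>F n in sequentially. c * ?\<rho> n < L + e)"
    using bounded_sequence_sup_limit[of "\<lambda>n. c * ?\<rho> n" "1 / \<alpha>"] by presburger
  then obtain \<sigma> where "(\<forall>n. n \<le> \<sigma> n) \<and> (\<lambda>n. c * ?\<rho> (\<sigma> n)) \<longlonglongrightarrow> L \<and>
      (\<forall>e>0. \<forall>\<^sub>F n in sequentially. c * ?\<rho> n < L + e)" ..
  then have \<sigma>: "\<And>n. n \<le> \<sigma> n" and L: "(\<lambda>n. c * ?\<rho> (\<sigma> n)) \<longlonglongrightarrow> L"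
    and sup: "\<And>e. e > 0 \<Longrightarrow> \<forall>\<^sub>F n in sequentially. c * ?\<rho> n < L + e"
    by simp_all
  obtain w where "\<exists>\<tau>. strict_mono \<tau> \<and> (\<forall>k. w k \<in> {0..1 / \<alpha>} \<and>
      (\<lambda>n. (1 - r (\<sigma> (\<tau> n) + k)) / (1 - r (\<sigma> (\<tau> n)))) \<longlonglongrightarrow> w k)"
    using pointwise_convergent_subsequence[of "\<lambda>n k. (1 - r (\<sigma> n + k)) / (1 - r (\<sigma> n))" 0 "1 / \<alpha>", OF ratio] ..
  then obtain \<tau> where \<tau>: "strict_mono \<tau>" and w01: "\<And>k. w k \<in> {0..1 / \<alpha>}"
    and w: "\<And>k. (\<lambda>n. (1 - r (\<sigma> (\<tau> n) + k)) / (1 - r (\<sigma> (\<tau> n)))) \<longlonglongrightarrow> w k"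
    by auto
  have \<sigma>\<tau>: "filterlim (\<lambda>n. \<sigma> (\<tau> n)) sequentially sequentially"
  proof (rule filterlim_at_top_mono[OF filterlim_subseq[OF \<tau>]])
    show "\<forall>\<^sub>F n in sequentially. \<tau> n \<le> \<sigma> (\<tau> n)"
      using \<sigma> by simp
  qed
  have har: "harmonic w"
    by (rule rescaled_limit_harmonic[OF r less lim \<alpha> \<sigma>\<tau> w])
  have w0: "w 0 = 1"
  proof (rule LIMSEQ_unique[OF w])
    have "1 - r n \<noteq> 0" for n
      using less[of n] by simp
    then show "(\<lambda>n. (1 - r (\<sigma> (\<tau> n) + 0)) / (1 - r (\<sigma> (\<tau> n)))) \<longlonglongrightarrow> 1"
      by simp
  qed
  have cw: "c * w 1 = L"
  proof (rule LIMSEQ_unique)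
    show "(\<lambda>n. c * ?\<rho> (\<sigma> (\<tau> n))) \<longlonglongrightarrow> c * w 1"
      by (intro tendsto_mult tendsto_const w)
    show "(\<lambda>n. c * ?\<rho> (\<sigma> (\<tau> n))) \<longlonglongrightarrow> L"
      using LIMSEQ_subseq_LIMSEQ[OF L \<tau>] by (simp add: o_def)
  qed
  have extremal: "0 \<le> c * (w 1 * w k - w (Suc k))" for k
  proof (rule field_le_epsilon)
    fix e :: real assume "e > 0"
    \<comment> \<open>The factor \<open>\<alpha>\<close> compensates for the bound \<open>1 / \<alpha>\<close> on \<open>w\<close>.\<close>
    define e' where "e' = e * \<alpha>"
    have "e' > 0"
      using \<open>e > 0\<close> \<alpha> by (simp add: e'_def)
    have "c * w (Suc k) \<le> (c * w 1 + e') * w k"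
    proof (rule LIMSEQ_le)
      show "(\<lambda>n. c * ((1 - r (\<sigma> (\<tau> n) + Suc k)) / (1 - r (\<sigma> (\<tau> n))))) \<longlonglongrightarrow> c * w (Suc k)"
        by (intro tendsto_mult tendsto_const w)
      show "(\<lambda>n. (c * w 1 + e') * ((1 - r (\<sigma> (\<tau> n) + k)) / (1 - r (\<sigma> (\<tau> n))))) \<longlonglongrightarrow> (c * w 1 + e') * w k"
        by (intro tendsto_mult tendsto_const w)
      have shift: "filterlim (\<lambda>n. \<sigma> (\<tau> n) + k) sequentially sequentially"
        using filterlim_compose[OF filterlim_add_const_nat_at_top \<sigma>\<tau>] .
      have "\<forall>\<^sub>F n in sequentially. c * ?\<rho> (\<sigma> (\<tau> n) + k) < c * w 1 + e'"
        using sup[OF \<open>e' > 0\<close>] shift unfolding cw filterlim_iff by fast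
      then have "\<forall>\<^sub>F n in sequentially. c * ((1 - r (\<sigma> (\<tau> n) + Suc k)) / (1 - r (\<sigma> (\<tau> n))))
          \<le> (c * w 1 + e') * ((1 - r (\<sigma> (\<tau> n) + k)) / (1 - r (\<sigma> (\<tau> n))))"
      proof eventually_elim
        case (elim n)
        let ?m = "\<sigma> (\<tau> n)"
        have pos: "1 - r ?m > 0" "1 - r (?m + k) > 0"
          using less by simp_all
        have "c * ((1 - r (?m + Suc k)) / (1 - r ?m)) = c * ?\<rho> (?m + k) * ((1 - r (?m + k)) / (1 - r ?m))"
          using pos by simp
        also have "\<dots> \<le> (c * w 1 + e') * ((1 - r (?m + k)) / (1 - r ?m))"
          by (rule mult_right_mono) (use elim pos in simp_all)
        finally show ?case .
      qed
      then show "\<exists>N. \<forall>n\<ge>N. c * ((1 - r (\<sigma> (\<tau> n) + Suc k)) / (1 - r (\<sigma> (\<tau> n))))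
          \<le> (c * w 1 + e') * ((1 - r (\<sigma> (\<tau> n) + k)) / (1 - r (\<sigma> (\<tau> n))))"
        unfolding eventually_sequentially .
    qed
    moreover have "e' * w k \<le> e' * (1 / \<alpha>)"
      using w01[of k] \<open>e' > 0\<close> by (intro mult_left_mono) simp_all
    moreover have "e' * (1 / \<alpha>) = e"
      using \<alpha> by (simp add: e'_def)
    ultimately show "0 \<le> c * (w 1 * w k - w (Suc k)) + e"
      by (simp add: algebra_simps)
  qed
  have geometric: "w k = w 1 ^ k" for k
    by (rule harmonic_extremal_ratio[where C = "1 / \<alpha>", OF har _ _ w0 c extremal]) (use w01 in simp_all)
  have "w 0 = expect (\<lambda>j. \<Sum>k\<in>#j. w (0 + k))"
    using har unfolding harmonic_def by (rule spec)
  then have root: "characteristic_root (w 1)"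
    unfolding characteristic_root_def w0 add_0 geometric[symmetric] by (rule sym)
  have "w 1 \<in> {0<..<1}"
  proof (rule characteristic_root_bounds[OF root])
    show "w 1 ^ k \<le> 1 / \<alpha>" for k
      using w01[of k] geometric[of k] by simp
  qed (use w01[of 1] in simp)
  then show ?thesis
    using root sup cw by (intro bexI[of _ "w 1"] conjI allI impI) simp_all
qed

text \<open>
  The limits superior and inferior are both roots of the characteristic equation, which has only one.
\<close>

lemma fixed_point_ratio:
  assumes r: "r \<in> fixed_points P" and ne: "r \<noteq> (\<lambda>_. extinction_root)" "r \<noteq> (\<lambda>_. 1)"
  shows "\<exists>\<gamma>\<in>{0<..<1}. characteristic_root \<gamma> \<and> (\<lambda>i. (1 - r (i + 1)) / (1 - r i)) \<longlonglongrightarrow> \<gamma>"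
proof -
  obtain \<alpha> where \<alpha>: "\<alpha> \<in> {0<..1}" "\<forall>j. level_pgf 0 j \<le> 1 - \<alpha>"
    using level_pgf_bounded ..
  then have \<alpha>: "\<alpha> > 0" "\<And>j. level_pgf 0 j \<le> 1 - \<alpha>"
    by simp_all
  have less: "r i < 1" for i
    by (rule fixed_point_less_1[OF r ne(2)])
  have lim: "r \<longlonglongrightarrow> 1"
    by (rule fixed_point_tendsto_1[OF r ne(1) \<alpha>])
  note extremal = extremal_ratio_is_root[OF r less lim \<alpha>]
  obtain \<gamma> where \<gamma>: "\<gamma> \<in> {0<..<1}" "characteristic_root \<gamma>"
    and upper: "\<forall>e>0. \<forall>\<^sub>F n in sequentially. 1 * ((1 - r (n + 1)) / (1 - r n)) < 1 * \<gamma> + e"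
    using extremal[of 1] by auto
  obtain \<gamma>' where \<gamma>': "\<gamma>' \<in> {0<..<1}" "characteristic_root \<gamma>'"
    and lower: "\<forall>e>0. \<forall>\<^sub>F n in sequentially. -1 * ((1 - r (n + 1)) / (1 - r n)) < -1 * \<gamma>' + e"
    using extremal[of "-1"] by auto
  have "\<gamma>' = \<gamma>"
    using \<gamma> \<gamma>' by (intro characteristic_root_unique)
  have "(\<lambda>i. (1 - r (i + 1)) / (1 - r i)) \<longlonglongrightarrow> \<gamma>"
  proof (rule tendstoI)
    fix e :: real assume "e > 0"
    then have "\<forall>\<^sub>F n in sequentially. 1 * ((1 - r (n + 1)) / (1 - r n)) < 1 * \<gamma> + e"
      "\<forall>\<^sub>F n in sequentially. -1 * ((1 - r (n + 1)) / (1 - r n)) < -1 * \<gamma> + e"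
      using upper lower unfolding \<open>\<gamma>' = \<gamma>\<close> by simp_all
    then show "\<forall>\<^sub>F n in sequentially. dist ((1 - r (n + 1)) / (1 - r n)) \<gamma> < e"
    proof eventually_elim
      case (elim n)
      then show ?case
        unfolding dist_real_def by linarith
    qed
  qed
  then show ?thesis
    using \<gamma> by blast
qed

end

section \<open>The process\<close>

instance multiset :: (countable) countable
proof
  have "inj (\<lambda>M :: 'a multiset. to_nat (SOME xs. mset xs = M))"
  proof (rule injI)
    fix M N :: "'a multiset"
    assume "to_nat (SOME xs. mset xs = M) = to_nat (SOME xs. mset xs = N)"
    then have "mset (SOME xs. mset xs = M) = mset (SOME xs. mset xs = N)"
      by simp
    then show "M = N"
      using someI_ex[OF ex_mset, of M] someI_ex[OF ex_mset, of N] by simp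
  qed
  then show "\<exists>f :: 'a multiset \<Rightarrow> nat. inj f"
    by blast
qed

lemma measurable_countable_binop:
  fixes f g :: "'a \<Rightarrow> 'b :: countable"
  assumes "f \<in> M \<rightarrow>\<^sub>M count_space UNIV" "g \<in> M \<rightarrow>\<^sub>M count_space UNIV"
  shows "(\<lambda>x. h (f x) (g x)) \<in> M \<rightarrow>\<^sub>M count_space UNIV"
proof (rule measurable_compose_countable[OF _ assms(1)])
  show "(\<lambda>x. h a (g x)) \<in> M \<rightarrow>\<^sub>M count_space UNIV" for a
    by (rule measurable_compose[OF assms(2)]) simp
qed

lemma measurable_countable_sum:
  fixes f :: "'i \<Rightarrow> 'a \<Rightarrow> 'b :: {countable, comm_monoid_add}"
  assumes "finite A" "\<And>t. t \<in> A \<Longrightarrow> f t \<in> M \<rightarrow>\<^sub>M count_space UNIV"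
  shows "(\<lambda>x. \<Sum>t\<in>A. f t x) \<in> M \<rightarrow>\<^sub>M count_space UNIV"
  using assms
proof (induction A rule: finite_induct)
  case (insert t A)
  then have "(\<lambda>x. f t x + (\<Sum>t\<in>A. f t x)) \<in> M \<rightarrow>\<^sub>M count_space UNIV"
    by (intro measurable_countable_binop[where h = "(+)"]) simp_all
  then show ?case
    using insert.hyps by simp
qed simp

text \<open>
  The generations up to \<open>n\<close> are a function of the coordinates in \<open>past n\<close>, and generation \<open>n + 1\<close> is
  obtained from generation \<open>n\<close> with the coordinates in \<open>present n\<close>.
\<close>

definition past :: "nat \<Rightarrow> (nat \<times> nat \<times> nat) set" where
  "past n = {(m, t, l). m < n}"

definition present :: "nat \<Rightarrow> (nat \<times> nat \<times> nat) set" where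
  "present n = {(m, t, l). m = n}"

definition history :: "nat \<Rightarrow> (nat \<times> nat \<times> nat \<Rightarrow> nat multiset) \<Rightarrow> nat \<Rightarrow> nat multiset list" where
  "history i \<omega> n = map (gw_process i \<omega>) [0..<Suc n]"

lemma measurable_coordinate:
  "x \<in> A \<Longrightarrow> (\<lambda>\<omega>. \<omega> x) \<in> PiM A (\<lambda>_. measure_pmf P) \<rightarrow>\<^sub>M count_space UNIV"
  using measurable_component_singleton[of x A "\<lambda>_. measure_pmf P"]
  by (simp add: measurable_pmf_measure2)

lemma measurable_gw_process:
  assumes "past n \<subseteq> A"
  shows "(\<lambda>\<omega>. gw_process i \<omega> n) \<in> PiM A (\<lambda>_. measure_pmf P) \<rightarrow>\<^sub>M count_space UNIV"
  using assms
proof (induction n)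
  case (Suc n)
  let ?M = "PiM A (\<lambda>_. measure_pmf P)"
  have sub: "past n \<subseteq> A" "\<And>t l. (n, t, l) \<in> A"
    using Suc.prems by (auto simp: past_def)
  have "(\<lambda>\<omega>. \<Sum>t\<in>set_mset z. \<Sum>l<count z t. image_mset (\<lambda>k. t + k) (\<omega> (n, t, l)))
      \<in> ?M \<rightarrow>\<^sub>M count_space UNIV" for z
    by (intro measurable_countable_sum finite_set_mset finite_lessThan
        measurable_compose[OF measurable_coordinate[OF sub(2)]]) simp
  then show ?case
    unfolding gw_process.simps by (rule measurable_compose_countable[OF _ Suc.IH[OF sub(1)]])
qed simp

lemma measurable_map_countable:
  fixes f :: "'i \<Rightarrow> 'a \<Rightarrow> 'b :: countable"
  assumes "\<And>m. m \<in> set ms \<Longrightarrow> f m \<in> M \<rightarrow>\<^sub>M count_space UNIV"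
  shows "(\<lambda>x. map (\<lambda>m. f m x) ms) \<in> M \<rightarrow>\<^sub>M count_space UNIV"
  using assms
proof (induction ms)
  case (Cons m ms)
  have "(\<lambda>x. f m x # map (\<lambda>m. f m x) ms) \<in> M \<rightarrow>\<^sub>M count_space UNIV"
  proof (rule measurable_compose_countable[of "\<lambda>a x. a # map (\<lambda>m. f m x) ms"])
    show "(\<lambda>x. a # map (\<lambda>m. f m x) ms) \<in> M \<rightarrow>\<^sub>M count_space UNIV" for a
      by (rule measurable_compose[OF Cons.IH]) (use Cons.prems in auto)
    show "f m \<in> M \<rightarrow>\<^sub>M count_space UNIV"
      using Cons.prems by simp
  qed
  then show ?case
    by simp
qed simp

lemma measurable_history:
  assumes "past n \<subseteq> A"
  shows "(\<lambda>\<omega>. history i \<omega> n) \<in> PiM A (\<lambda>_. measure_pmf P) \<rightarrow>\<^sub>M count_space UNIV"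
  unfolding history_def
proof (rule measurable_map_countable)
  fix m assume "m \<in> set [0..<Suc n]"
  then have "past m \<subseteq> A"
    using assms by (auto simp: past_def)
  then show "(\<lambda>\<omega>. gw_process i \<omega> m) \<in> PiM A (\<lambda>_. measure_pmf P) \<rightarrow>\<^sub>M count_space UNIV"
    by (rule measurable_gw_process)
qed

lemma gw_process_restrict:
  "past n \<subseteq> A \<Longrightarrow> gw_process i (restrict \<omega> A) n = gw_process i \<omega> n"
proof (induction n)
  case (Suc n)
  have sub: "past n \<subseteq> A" "\<And>t l. (n, t, l) \<in> A"
    using Suc.prems by (auto simp: past_def)
  then show ?case
    using Suc.IH by simp
qed simp

lemma history_restrict: "history i (restrict \<omega> (past n)) n = history i \<omega> n"
  unfolding history_def
proof (rule map_cong[OF refl])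
  fix m assume "m \<in> set [0..<Suc n]"
  then have "past m \<subseteq> past n"
    by (auto simp: past_def)
  then show "gw_process i (restrict \<omega> (past n)) m = gw_process i \<omega> m"
    by (rule gw_process_restrict)
qed

lemma last_history: "last (history i \<omega> n) = gw_process i \<omega> n"
  by (simp add: history_def)

lemma prob_space_gw_space: "prob_space (gw_space P)"
  unfolding gw_space_def by (intro prob_space_PiM prob_space_measure_pmf)

lemma space_gw_space [simp]: "space (gw_space P) = UNIV"
  by (simp add: gw_space_def space_PiM)

lemma measurable_gw_space:
  "(\<lambda>\<omega>. gw_process i \<omega> n) \<in> gw_space P \<rightarrow>\<^sub>M count_space UNIV"
  "(\<lambda>\<omega>. history i \<omega> n) \<in> gw_space P \<rightarrow>\<^sub>M count_space UNIV"
  unfolding gw_space_def by (rule measurable_gw_process measurable_history, simp)+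

lemma distr_coordinate: "distr (gw_space P) (measure_pmf P) (\<lambda>\<omega>. \<omega> c) = measure_pmf P"
  unfolding gw_space_def by (rule distr_PiM_component) (simp_all add: prob_space_measure_pmf)

lemma indep_coordinates:
  "prob_space.indep_vars (gw_space P) (\<lambda>_. measure_pmf P) (\<lambda>c \<omega>. \<omega> c) UNIV"
proof -
  interpret prob_space "gw_space P"
    by (rule prob_space_gw_space)
  show ?thesis
  proof (subst indep_vars_iff_distr_eq_PiM)
    show "random_variable (measure_pmf P) (\<lambda>\<omega>. \<omega> c)" for c
      unfolding gw_space_def by (rule measurable_component_singleton) simp
    have "distr (gw_space P) (\<Pi>\<^sub>M c\<in>UNIV. measure_pmf P) (\<lambda>\<omega>. \<lambda>c\<in>UNIV. \<omega> c) = gw_space P"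
      unfolding gw_space_def by (simp add: restrict_UNIV distr_id)
    also have "\<dots> = (\<Pi>\<^sub>M c\<in>UNIV. distr (gw_space P) (measure_pmf P) (\<lambda>\<omega>. \<omega> c))"
      unfolding distr_coordinate by (rule gw_space_def)
    finally show "distr (gw_space P) (\<Pi>\<^sub>M c\<in>UNIV. measure_pmf P) (\<lambda>\<omega>. \<lambda>c\<in>UNIV. \<omega> c)
      = (\<Pi>\<^sub>M c\<in>UNIV. distr (gw_space P) (measure_pmf P) (\<lambda>\<omega>. \<omega> c))" .
  qed simp
qed

definition offspring_product ::
  "(nat \<Rightarrow> real) \<Rightarrow> nat \<Rightarrow> nat multiset \<Rightarrow> (nat \<times> nat \<times> nat \<Rightarrow> nat multiset) \<Rightarrow> real" where
  "offspring_product s n z \<omega> = (\<Prod>t\<in>set_mset z. \<Prod>l<count z t. \<Prod>k\<in>#\<omega> (n, t, l). s (t + k))"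

lemma prod_mset_sum:
  fixes s :: "'a \<Rightarrow> 'b :: comm_monoid_mult"
  shows "finite A \<Longrightarrow> (\<Prod>x\<in>#(\<Sum>t\<in>A. M t). s x) = (\<Prod>t\<in>A. \<Prod>x\<in>#M t. s x)"
  by (induction A rule: finite_induct) auto

lemma prod_next_generation:
  "(\<Prod>x\<in>#gw_process i \<omega> (Suc n). s x) = offspring_product s n (gw_process i \<omega> n) \<omega>"
  by (simp add: offspring_product_def prod_mset_sum image_mset.compositionality o_def)

lemma nn_integral_offspring_product:
  assumes s: "\<And>k. s k \<in> {0..1}"
  shows "(\<integral>\<^sup>+\<omega>. ennreal (offspring_product s n z \<omega>) \<partial>gw_space P) = ennreal (\<Prod>t\<in>#z. gen_fun P t s)"
proof -
  interpret prob_space "gw_space P"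
    by (rule prob_space_gw_space)
  let ?J = "(\<lambda>(t, l). (n, t, l)) ` (SIGMA t : set_mset z. {..<count z t})"
  have reindex: "(\<Prod>c\<in>?J. g c) = (\<Prod>t\<in>set_mset z. \<Prod>l<count z t. g (n, t, l))"
    for g :: "nat \<times> nat \<times> nat \<Rightarrow> real"
    by (subst prod.reindex) (auto simp: inj_on_def prod.Sigma case_prod_unfold)
  let ?X = "\<lambda>t j. ennreal (\<Prod>k\<in>#j. s (t + k))"
  have prod01: "(\<Prod>k\<in>#j. s (t + k)) \<in> {0..1}" for j t
    by (rule prod_mset_unit_interval) (rule s)
  have inner: "(\<integral>\<^sup>+\<omega>. ?X t (\<omega> c) \<partial>gw_space P) = ennreal (gen_fun P t s)" for t c
  proof -
    have "(\<integral>\<^sup>+\<omega>. ?X t (\<omega> c) \<partial>gw_space P) = (\<integral>\<^sup>+j. ?X t j \<partial>distr (gw_space P) (measure_pmf P) (\<lambda>\<omega>. \<omega> c))"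
      by (subst nn_integral_distr) (simp_all add: gw_space_def)
    also have "\<dots> = ennreal (measure_pmf.expectation P (\<lambda>j. \<Prod>k\<in>#j. s (t + k)))"
      unfolding distr_coordinate
      by (rule nn_integral_eq_integral[OF integrable_prod_mset]) (use s prod01 in auto)
    finally show ?thesis
      by (simp only: gen_fun_shift[of P t] gen_fun_0)
  qed
  have gen01: "gen_fun P t s \<in> {0..1}" for t
    unfolding gen_fun_shift[of P t] by (rule gen_fun_unit_interval) (rule s)
  have "indep_vars (\<lambda>_. measure_pmf P) (\<lambda>c \<omega>. \<omega> c) ?J"
    by (rule indep_vars_subset[OF indep_coordinates subset_UNIV])
  then have "indep_vars (\<lambda>_. borel) (\<lambda>c \<omega>. ?X (fst (snd c)) (\<omega> c)) ?J"
    by (rule indep_vars_compose2) simp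
  then have "(\<integral>\<^sup>+\<omega>. (\<Prod>c\<in>?J. ?X (fst (snd c)) (\<omega> c)) \<partial>gw_space P)
      = (\<Prod>c\<in>?J. \<integral>\<^sup>+\<omega>. ?X (fst (snd c)) (\<omega> c) \<partial>gw_space P)"
    by (intro indep_vars_nn_integral) simp_all
  also have "\<dots> = ennreal (\<Prod>c\<in>?J. gen_fun P (fst (snd c)) s)"
    unfolding inner by (rule prod_ennreal) (use gen01 in auto)
  also have "(\<Prod>c\<in>?J. gen_fun P (fst (snd c)) s) = (\<Prod>t\<in>#z. gen_fun P t s)"
    unfolding reindex by (simp add: image_prod_mset_multiplicity)
  also have "(\<lambda>\<omega>. \<Prod>c\<in>?J. ?X (fst (snd c)) (\<omega> c)) = (\<lambda>\<omega>. ennreal (offspring_product s n z \<omega>))"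
  proof
    fix \<omega> :: "nat \<times> nat \<times> nat \<Rightarrow> nat multiset"
    have "(\<Prod>c\<in>?J. ?X (fst (snd c)) (\<omega> c)) = ennreal (\<Prod>c\<in>?J. \<Prod>k\<in>#\<omega> c. s (fst (snd c) + k))"
      by (rule prod_ennreal) (use prod01 in auto)
    then show "(\<Prod>c\<in>?J. ?X (fst (snd c)) (\<omega> c)) = ennreal (offspring_product s n z \<omega>)"
      unfolding reindex offspring_product_def by simp
  qed
  finally show ?thesis .
qed

text \<open>
  The branching property: given the past, the particles of generation \<open>n\<close> have independent
  offspring.  The past and the coordinates of generation \<open>n\<close> are independent families, so the
  joint law is a product and the latter can be integrated out first.
\<close>

lemma branching_step:
  assumes s: "\<And>k. s k \<in> {0..1}"
  shows "(\<integral>\<^sup>+\<omega>. \<Phi> (history i \<omega> n) * ennreal (\<Prod>x\<in>#gw_process i \<omega> (Suc n). s x) \<partial>gw_space P)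
    = (\<integral>\<^sup>+\<omega>. \<Phi> (history i \<omega> n) * ennreal (\<Prod>t\<in>#gw_process i \<omega> n. gen_fun P t s) \<partial>gw_space P)"
proof -
  interpret prob_space "gw_space P"
    by (rule prob_space_gw_space)
  let ?M = "gw_space P"
  let ?L = "PiM (past n) (\<lambda>_. measure_pmf P)"
  let ?N = "PiM (present n) (\<lambda>_. measure_pmf P)"
  let ?X = "\<lambda>\<omega> :: nat \<times> nat \<times> nat \<Rightarrow> nat multiset. restrict \<omega> (past n)"
  let ?Y = "\<lambda>\<omega> :: nat \<times> nat \<times> nat \<Rightarrow> nat multiset. restrict \<omega> (present n)"
  let ?h = "\<lambda>p. \<Phi> (history i (fst p) n) * ennreal (offspring_product s n (last (history i (fst p) n)) (snd p))"
  have indep: "indep_var ?L ?X ?N ?Y"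
    by (rule indep_var_restrict[OF indep_coordinates]) (auto simp: past_def present_def)
  then have X: "?X \<in> ?M \<rightarrow>\<^sub>M ?L" and Y: "?Y \<in> ?M \<rightarrow>\<^sub>M ?N"
    and joint: "distr ?M ?L ?X \<Otimes>\<^sub>M distr ?M ?N ?Y = distr ?M (?L \<Otimes>\<^sub>M ?N) (\<lambda>\<omega>. (?X \<omega>, ?Y \<omega>))"
    by (simp_all only: indep_var_distribution_eq)
  have hist: "(\<lambda>x. history i x n) \<in> ?L \<rightarrow>\<^sub>M count_space UNIV"
    by (rule measurable_history) simp
  have meas_N: "(\<lambda>y. ennreal (offspring_product s n z y)) \<in> borel_measurable ?N" for z
    unfolding offspring_product_def
    by (intro measurable_compose[OF _ measurable_ennreal] borel_measurable_prod
        measurable_compose[OF measurable_coordinate]) (simp_all add: present_def)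
  have meas_M: "(\<lambda>y. ennreal (offspring_product s n z y)) \<in> borel_measurable ?M" for z
    unfolding offspring_product_def gw_space_def
    by (intro measurable_compose[OF _ measurable_ennreal] borel_measurable_prod
        measurable_compose[OF measurable_coordinate]) simp_all
  have h: "?h \<in> borel_measurable (?L \<Otimes>\<^sub>M ?N)"
  proof (rule measurable_compose_countable[of "\<lambda>z p. \<Phi> z * ennreal (offspring_product s n (last z) (snd p))"])
    show "(\<lambda>p. \<Phi> z * ennreal (offspring_product s n (last z) (snd p))) \<in> borel_measurable (?L \<Otimes>\<^sub>M ?N)" for z
      by (intro borel_measurable_times_ennreal measurable_compose[OF measurable_snd meas_N]) simp
    show "(\<lambda>p. history i (fst p) n) \<in> ?L \<Otimes>\<^sub>M ?N \<rightarrow>\<^sub>M count_space UNIV"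
      by (rule measurable_compose[OF measurable_fst hist])
  qed
  interpret Y: prob_space "distr ?M ?N ?Y"
    by (rule prob_space_distr[OF Y])
  have offspring_restrict: "offspring_product s n z (?Y \<omega>) = offspring_product s n z \<omega>" for z \<omega>
    by (simp add: offspring_product_def present_def)
  let ?F = "\<lambda>z. \<Phi> z * ennreal (\<Prod>t\<in>#last z. gen_fun P t s)"
  have "(\<integral>\<^sup>+\<omega>. \<Phi> (history i \<omega> n) * ennreal (\<Prod>x\<in>#gw_process i \<omega> (Suc n). s x) \<partial>?M)
      = (\<integral>\<^sup>+\<omega>. ?h (?X \<omega>, ?Y \<omega>) \<partial>?M)"
    unfolding prod_next_generation fst_conv snd_conv history_restrict offspring_restrict last_history ..
  also have "\<dots> = (\<integral>\<^sup>+p. ?h p \<partial>distr ?M (?L \<Otimes>\<^sub>M ?N) (\<lambda>\<omega>. (?X \<omega>, ?Y \<omega>)))"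
    by (rule nn_integral_distr[unfolded measurable_distr_eq1, OF measurable_Pair[OF X Y] h, symmetric])
  also have "\<dots> = (\<integral>\<^sup>+x. \<integral>\<^sup>+y. ?h (x, y) \<partial>distr ?M ?N ?Y \<partial>distr ?M ?L ?X)"
    unfolding joint[symmetric]
  proof (rule Y.nn_integral_fst[symmetric])
    have eq: "sets (distr ?M ?L ?X \<Otimes>\<^sub>M distr ?M ?N ?Y) = sets (?L \<Otimes>\<^sub>M ?N)"
      by (rule sets_pair_measure_cong) simp_all
    show "?h \<in> borel_measurable (distr ?M ?L ?X \<Otimes>\<^sub>M distr ?M ?N ?Y)"
      unfolding measurable_cong_sets[OF eq refl] by (rule h)
  qed
  also have "\<dots> = (\<integral>\<^sup>+x. ?F (history i x n) \<partial>distr ?M ?L ?X)"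
  proof (rule nn_integral_cong)
    fix x
    let ?z = "history i x n"
    have "(\<integral>\<^sup>+y. ?h (x, y) \<partial>distr ?M ?N ?Y) = (\<integral>\<^sup>+y. \<Phi> ?z * ennreal (offspring_product s n (last ?z) y) \<partial>distr ?M ?N ?Y)"
      by (simp only: fst_conv snd_conv)
    also have "\<dots> = (\<integral>\<^sup>+\<omega>. \<Phi> ?z * ennreal (offspring_product s n (last ?z) (?Y \<omega>)) \<partial>?M)"
      by (rule nn_integral_distr[unfolded measurable_distr_eq1, OF Y borel_measurable_times_ennreal[OF borel_measurable_const meas_N]])
    also have "\<dots> = ?F ?z"
      by (simp only: offspring_restrict nn_integral_cmult[OF meas_M] nn_integral_offspring_product[OF s])
    finally show "(\<integral>\<^sup>+y. ?h (x, y) \<partial>distr ?M ?N ?Y) = ?F ?z" .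
  qed
  also have "\<dots> = (\<integral>\<^sup>+\<omega>. ?F (history i (?X \<omega>) n) \<partial>?M)"
  proof (rule nn_integral_distr[unfolded measurable_distr_eq1, OF X])
    show "(\<lambda>x. ?F (history i x n)) \<in> borel_measurable ?L"
      by (rule measurable_compose[OF hist]) simp
  qed
  finally show ?thesis
    unfolding history_restrict last_history .
qed

section \<open>Extinction\<close>

lemma gen_fun_iterate_unit_interval:
  assumes "\<And>k. s k \<in> {0..1}"
  shows "((\<lambda>s i. gen_fun P i s) ^^ n) s k \<in> {0..1}"
proof (induction n arbitrary: k)
  case (Suc n)
  have "gen_fun P 0 (\<lambda>l. ((\<lambda>s i. gen_fun P i s) ^^ n) s (k + l)) \<in> {0..1}"
    by (rule gen_fun_unit_interval) (rule Suc)
  then show ?case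
    by (simp add: gen_fun_shift[of P k])
qed (use assms in simp)

lemma expectation_generation:
  assumes s: "\<And>k. s k \<in> {0..1}"
  shows "(\<integral>\<^sup>+\<omega>. ennreal (\<Prod>x\<in>#gw_process i \<omega> n. s x) \<partial>gw_space P)
    = ennreal (((\<lambda>s i. gen_fun P i s) ^^ n) s i)"
  using s
proof (induction n arbitrary: s)
  case 0
  show ?case
    by (simp add: prob_space.emeasure_space_1[OF prob_space_gw_space, unfolded space_gw_space])
next
  case (Suc n)
  have F01: "gen_fun P k s \<in> {0..1}" for k
    using gen_fun_iterate_unit_interval[of s "Suc 0" P k] Suc.prems by simp
  have "(\<integral>\<^sup>+\<omega>. ennreal (\<Prod>x\<in>#gw_process i \<omega> (Suc n). s x) \<partial>gw_space P)
      = (\<integral>\<^sup>+\<omega>. ennreal (\<Prod>x\<in>#gw_process i \<omega> n. gen_fun P x s) \<partial>gw_space P)"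
    using branching_step[OF Suc.prems, where \<Phi> = "\<lambda>_. 1" and i = i and n = n and P = P] by (simp only: mult_1_left)
  also have "\<dots> = ennreal (((\<lambda>s i. gen_fun P i s) ^^ n) (\<lambda>k. gen_fun P k s) i)"
    by (rule Suc.IH[OF F01])
  also have "\<dots> = ennreal (((\<lambda>s i. gen_fun P i s) ^^ Suc n) s i)"
    by (simp only: funpow_Suc_right o_apply)
  finally show ?case .
qed

lemma sets_history: "{\<omega>. Q (history i \<omega> n)} \<in> sets (gw_space P)"
  using measurable_sets[OF measurable_gw_space(2)[where i = i and n = n and P = P], of "{h. Q h}"] by (simp add: vimage_def)

lemma sets_gw_process: "{\<omega>. Q (gw_process i \<omega> n)} \<in> sets (gw_space P)"
  using measurable_sets[OF measurable_gw_space(1)[where i = i and n = n and P = P], of "{h. Q h}"] by (simp add: vimage_def)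

lemma tendsto_size_filter_iff:
  "(\<lambda>n. size {#l \<in># Z n. l \<in> T#}) \<longlonglongrightarrow> 0 \<longleftrightarrow> (\<forall>\<^sub>F n in sequentially. \<forall>l\<in>T. l \<notin># Z n)"
proof -
  have eq: "size {#l \<in># Z n. l \<in> T#} = 0 \<longleftrightarrow> (\<forall>l\<in>T. l \<notin># Z n)" for n
    unfolding size_eq_0_iff_empty set_mset_eq_empty_iff[symmetric] by auto
  show ?thesis
  proof
    assume "(\<lambda>n. size {#l \<in># Z n. l \<in> T#}) \<longlonglongrightarrow> 0"
    then have "\<forall>\<^sub>F n in sequentially. size {#l \<in># Z n. l \<in> T#} < 1"
      by (rule order_tendstoD(2)) simp
    then show "\<forall>\<^sub>F n in sequentially. \<forall>l\<in>T. l \<notin># Z n"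
      by eventually_elim (use eq in simp)
  next
    assume "\<forall>\<^sub>F n in sequentially. \<forall>l\<in>T. l \<notin># Z n"
    then have "\<forall>\<^sub>F n in sequentially. size {#l \<in># Z n. l \<in> T#} = 0"
      by eventually_elim (use eq in blast)
    then show "(\<lambda>n. size {#l \<in># Z n. l \<in> T#}) \<longlonglongrightarrow> 0"
      by (rule tendsto_eventually)
  qed
qed

definition extinction_event :: "nat set \<Rightarrow> nat \<Rightarrow> (nat \<times> nat \<times> nat \<Rightarrow> nat multiset) set" where
  "extinction_event T i = {\<omega>. \<forall>\<^sub>F n in sequentially. \<forall>l\<in>T. l \<notin># gw_process i \<omega> n}"

lemma extinction_prob_eq: "extinction_prob P T i = measure (gw_space P) (extinction_event T i)"
  by (simp add: extinction_prob_def extinction_event_def tendsto_size_filter_iff)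

lemma sets_extinction_event: "extinction_event T i \<in> sets (gw_space P)"
proof -
  have "extinction_event T i = (\<Union>N. \<Inter>n. {\<omega>. \<forall>l\<in>T. l \<notin># gw_process i \<omega> (N + n)})"
    by (auto simp: extinction_event_def eventually_sequentially le_iff_add)
  also have "\<dots> \<in> sets (gw_space P)"
    using sets.top[of "gw_space P"]
    by (intro sets.countable_UN sets.countable_INT'' sets_gw_process image_subsetI) simp_all
  finally show ?thesis .
qed

context offspring_law
begin

text \<open>
  The probability that generation \<open>n\<close> is empty is the \<open>n\<close>-th iterate of the total generating
  function at 0.  These numbers increase to a fixed point, and an empty generation settles the
  extinction of every set of types.
\<close>

lemma extinction_probability_limit:
  "\<exists>L\<in>{0..1}. total_pgf L = L \<and> (\<forall>T i. L \<le> extinction_prob P T i)"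
proof -
  interpret M: prob_space "gw_space P"
    by (rule prob_space_gw_space)
  define e where "e n = (total_pgf ^^ n) 0" for n
  have e_Suc: "e (Suc n) = total_pgf (e n)" for n
    by (simp add: e_def)
  have e01: "e n \<in> {0..1}" for n
  proof (induction n)
    case (Suc n)
    show ?case
      unfolding e_Suc by (rule gen_fun_unit_interval) (rule Suc)
  qed (simp add: e_def)
  have const: "((\<lambda>s i. gen_fun P i s) ^^ n) (\<lambda>_. 0) k = e n" for n k
  proof (induction n arbitrary: k)
    case (Suc n)
    have "((\<lambda>s i. gen_fun P i s) ^^ n) (\<lambda>_. 0) = (\<lambda>_. e n)"
      using Suc by (rule ext)
    then show ?case
      by (simp add: e_Suc gen_fun_shift[of P k])
  qed (simp add: e_def)
  have "e n \<le> e (Suc n)" for n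
  proof (induction n)
    case 0
    show ?case
      using e01[of "Suc 0"] by (simp add: e_def)
  next
    case (Suc n)
    then have "total_pgf (e n) \<le> total_pgf (e (Suc n))"
      by (intro gen_fun_mono e01)
    then show ?case
      by (simp only: e_Suc)
  qed
  then have "incseq e"
    by (rule incseq_SucI)
  moreover have "\<forall>n. e n \<le> 1"
    using e01 by simp
  ultimately obtain L where L: "e \<longlonglongrightarrow> L" and "\<forall>n. e n \<le> L"
    by (rule incseq_convergent)
  have L01: "L \<in> {0..1}"
    using LIMSEQ_le_const[OF L, of 0] LIMSEQ_le_const2[OF L, of 1] e01 by auto
  have "(\<lambda>n. total_pgf (e n)) \<longlonglongrightarrow> total_pgf L"
    by (intro gen_fun_tendsto e01 L)
  moreover have "(\<lambda>n. total_pgf (e n)) \<longlonglongrightarrow> L"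
    using LIMSEQ_Suc[OF L] by (simp only: e_Suc)
  ultimately have "total_pgf L = L"
    by (rule LIMSEQ_unique)
  moreover have "L \<le> extinction_prob P T i" for T i
  proof (rule LIMSEQ_le_const2[OF L], intro exI allI impI)
    fix n
    let ?A = "{\<omega>. gw_process i \<omega> n = {#}}"
    have "emeasure (gw_space P) ?A = (\<integral>\<^sup>+\<omega>. indicator ?A \<omega> \<partial>gw_space P)"
      by (rule nn_integral_indicator[symmetric]) (rule sets_gw_process)
    also have "\<dots> = (\<integral>\<^sup>+\<omega>. ennreal (\<Prod>x\<in>#gw_process i \<omega> n. 0) \<partial>gw_space P)"
    proof (rule nn_integral_cong)
      fix \<omega>
      show "indicator ?A \<omega> = ennreal (\<Prod>x\<in>#gw_process i \<omega> n. 0)"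
        by (cases "gw_process i \<omega> n") simp_all
    qed
    also have "\<dots> = ennreal (e n)"
      by (subst expectation_generation) (simp_all add: const)
    finally have "measure (gw_space P) ?A = e n"
      using e01[of n] by (simp add: measure_def)
    moreover have "?A \<subseteq> extinction_event T i"
    proof
      fix \<omega> assume "\<omega> \<in> ?A"
      then have "gw_process i \<omega> (n + k) = {#}" for k
        by (induction k) auto
      then have "gw_process i \<omega> m = {#}" if "m \<ge> n" for m
        using that le_Suc_ex by blast
      then show "\<omega> \<in> extinction_event T i"
        by (auto simp: extinction_event_def eventually_sequentially intro!: exI[of _ n])
    qed
    ultimately show "e n \<le> extinction_prob P T i"
      unfolding extinction_prob_eq by (metis M.finite_measure_mono sets_extinction_event)
  qed
  ultimately show ?thesis
    using L01 by blast
qed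

lemma from_level_iter_Suc:
  assumes "i \<noteq> k"
  shows "gen_fun P i (from_level k (level_iter 0 m)) = from_level k (level_iter 0 (Suc m)) i"
  unfolding gen_fun_from_level[of i] using assms by (simp add: from_level_def[of k])

text \<open>
  Generations are traded for iterations.  On the event that type \<open>k\<close> has not occurred, averaging
  over the next generation replaces \<open>level_iter 0 m\<close> by \<open>level_iter 0 (Suc m)\<close> at every particle;
  as the level functions vanish at type \<open>k\<close>, the product over a generation that contains \<open>k\<close> is 0,
  so the event may be tested one generation later or earlier.  Thus the expectation \<open>?V n m\<close> in the
  proof depends on \<open>n + m\<close> only.
\<close>

lemma emeasure_avoid:
  "emeasure (gw_space P) {\<omega>. \<forall>z\<in>set (history i \<omega> n). k \<notin># z} = ennreal (from_level k (level_iter 0 n) i)"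
proof -
  let ?a = "\<lambda>m. from_level k (level_iter 0 m)"
  let ?I = "\<lambda>h. if \<forall>z\<in>set h. k \<notin># z then 1 else 0 :: ennreal"
  have a01: "?a m x \<in> {0..1}" for m x
    by (intro from_level_unit_interval level_iter_unit_interval) simp
  have ak: "?a m k = 0" for m
    by (cases m) (simp_all add: from_level_def)
  have vanish: "(\<Prod>x\<in>#z. ?a m x) = 0" if "k \<in># z" for z m
    using that ak by force
  have mem: "gw_process i \<omega> n \<in> set (history i \<omega> n)" for \<omega> n
    by (simp add: history_def)
  have hist_Suc: "history i \<omega> (Suc n) = history i \<omega> n @ [gw_process i \<omega> (Suc n)]" for \<omega> n
    by (simp add: history_def)
  let ?V = "\<lambda>n m. \<integral>\<^sup>+\<omega>. ?I (history i \<omega> n) * ennreal (\<Prod>x\<in>#gw_process i \<omega> n. ?a m x) \<partial>gw_space P"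
  have step: "?V (Suc n) m = ?V n (Suc m)" for n m
  proof -
    have "?V (Suc n) m = (\<integral>\<^sup>+\<omega>. ?I (history i \<omega> n) * ennreal (\<Prod>x\<in>#gw_process i \<omega> (Suc n). ?a m x) \<partial>gw_space P)"
    proof (rule nn_integral_cong)
      fix \<omega>
      show "?I (history i \<omega> (Suc n)) * ennreal (\<Prod>x\<in>#gw_process i \<omega> (Suc n). ?a m x)
          = ?I (history i \<omega> n) * ennreal (\<Prod>x\<in>#gw_process i \<omega> (Suc n). ?a m x)"
        unfolding hist_Suc
        by (cases "k \<in># gw_process i \<omega> (Suc n)") (simp_all add: vanish del: gw_process.simps)
    qed
    also have "\<dots> = (\<integral>\<^sup>+\<omega>. ?I (history i \<omega> n) * ennreal (\<Prod>t\<in>#gw_process i \<omega> n. gen_fun P t (?a m)) \<partial>gw_space P)"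
      by (rule branching_step) (rule a01)
    also have "\<dots> = ?V n (Suc m)"
    proof (rule nn_integral_cong)
      fix \<omega>
      have "(\<Prod>t\<in>#gw_process i \<omega> n. gen_fun P t (?a m)) = (\<Prod>x\<in>#gw_process i \<omega> n. ?a (Suc m) x)"
        if "\<forall>z\<in>set (history i \<omega> n). k \<notin># z"
      proof (rule arg_cong[of _ _ prod_mset], rule image_mset_cong)
        fix t assume "t \<in># gw_process i \<omega> n"
        then have "t \<noteq> k"
          using that mem by blast
        then show "gen_fun P t (?a m) = ?a (Suc m) t"
          by (rule from_level_iter_Suc)
      qed
      then show "?I (history i \<omega> n) * ennreal (\<Prod>t\<in>#gw_process i \<omega> n. gen_fun P t (?a m))
          = ?I (history i \<omega> n) * ennreal (\<Prod>x\<in>#gw_process i \<omega> n. ?a (Suc m) x)"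
        by (simp del: level_iter.simps)
    qed
    finally show ?thesis .
  qed
  have V: "?V n m = ?V 0 (n + m)" for m
  proof (induction n arbitrary: m)
    case (Suc n)
    show ?case
      unfolding step Suc by (simp only: add_Suc add_Suc_right)
  qed (simp only: add_0)
  have "emeasure (gw_space P) {\<omega>. \<forall>z\<in>set (history i \<omega> n). k \<notin># z}
      = (\<integral>\<^sup>+\<omega>. indicator {\<omega>. \<forall>z\<in>set (history i \<omega> n). k \<notin># z} \<omega> \<partial>gw_space P)"
    by (rule nn_integral_indicator[symmetric]) (rule sets_history)
  also have "\<dots> = ?V n 0"
  proof (rule nn_integral_cong)
    fix \<omega>
    have "(\<Prod>x\<in>#gw_process i \<omega> n. ?a 0 x) = 1" if "\<forall>z\<in>set (history i \<omega> n). k \<notin># z"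
    proof -
      have "image_mset (?a 0) (gw_process i \<omega> n) = image_mset (\<lambda>_. 1) (gw_process i \<omega> n)"
      proof (rule image_mset_cong)
        fix x assume "x \<in># gw_process i \<omega> n"
        then have "x \<noteq> k"
          using that mem by blast
        then show "?a 0 x = 1"
          by (simp add: from_level_def)
      qed
      then show ?thesis
        by simp
    qed
    then show "indicator {\<omega>. \<forall>z\<in>set (history i \<omega> n). k \<notin># z} \<omega>
        = ?I (history i \<omega> n) * ennreal (\<Prod>x\<in>#gw_process i \<omega> n. ?a 0 x)"
      by (simp add: indicator_def del: level_iter.simps)
  qed
  also have "\<dots> = ?V 0 n"
    using V[of 0] by (simp only: add_0_right)
  also have "\<dots> = ennreal (?a n i)"
  proof -
    have "?a n i = 0" if "k = i"
      using ak[of n] that by simp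
    then show ?thesis
    by (simp add: history_def prob_space.emeasure_space_1[OF prob_space_gw_space, unfolded space_gw_space])
  qed
  finally show ?thesis .
qed

text \<open>
  For the function \<open>s\<close> that is 0 at \<open>k\<close> and 1 elsewhere, the terms are the probabilities that type
  \<open>k\<close> occurs in generation \<open>n\<close>.  Their partial sum at \<open>i\<close> is at most 1 plus the mean sum of the
  partial sums at the children.  The children of type \<open>i\<close> have mean number below 1 and can be
  absorbed, those of higher type are covered by the induction hypothesis, and types above \<open>k\<close>
  contribute nothing.
\<close>

lemma summable_occurrence:
  assumes s: "\<And>x. s x \<in> {0..1}" and s1: "\<And>x. x > k \<Longrightarrow> s x = 1"
  shows "\<exists>C. \<forall>N. (\<Sum>n<N. 1 - ((\<lambda>s i. gen_fun P i s) ^^ n) s i) \<le> C"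
proof (induction "Suc k - i" arbitrary: i rule: less_induct)
  case less
  let ?s = "\<lambda>n. ((\<lambda>s i. gen_fun P i s) ^^ n) s"
  let ?V = "\<lambda>N i. \<Sum>n<N. 1 - ?s n i"
  have s01: "?s n x \<in> {0..1}" for n x
    by (rule gen_fun_iterate_unit_interval) (rule s)
  have above: "?s n x = 1" if "x > k" for n x
    using that
  proof (induction n arbitrary: x)
    case (Suc n)
    have "(\<lambda>l. ?s n (x + l)) = (\<lambda>_. 1)"
    proof
      show "?s n (x + l) = 1" for l
        by (rule Suc.IH) (use Suc.prems in simp)
    qed
    then show ?case
      by (simp add: gen_fun_shift[of P x])
  qed (use s1 in simp)
  show ?case
  proof (cases "i > k")
    case True
    then show ?thesis
      using above by auto
  next
    case False
    have "\<exists>C. \<forall>l>0. \<forall>N. ?V N (i + l) \<le> C"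
    proof -
      have "\<forall>l\<in>{1..k}. \<exists>C. \<forall>N. ?V N (i + l) \<le> C"
      proof
        fix l assume "l \<in> {1..k}"
        then have "Suc k - (i + l) < Suc k - i"
          using False by auto
        then show "\<exists>C. \<forall>N. ?V N (i + l) \<le> C"
          by (rule less)
      qed
      then obtain c where c: "\<forall>l\<in>{1..k}. \<forall>N. ?V N (i + l) \<le> c l"
        by metis
      let ?C = "\<Sum>l\<in>{1..k}. \<bar>c l\<bar>"
      have "?V N (i + l) \<le> ?C" if "l > 0" for l N
      proof (cases "l \<le> k")
        case True
        have "?V N (i + l) \<le> c l"
          by (rule c[rule_format]) (use True that in simp)
        also have "\<dots> \<le> \<bar>c l\<bar>"
          by (rule abs_ge_self)
        also have "\<dots> \<le> ?C"
          by (rule member_le_sum) (use that True in auto)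
        finally show ?thesis .
      next
        case False
        then show ?thesis
          using above by (auto intro!: sum_nonneg)
      qed
      then show ?thesis
        by blast
    qed
    then obtain C where C: "\<forall>l>0. \<forall>N. ?V N (i + l) \<le> C" ..
    have V0: "0 \<le> ?V N x" for N x
      by (intro sum_nonneg) (use s01 in simp)
    have C0: "C \<ge> 0"
      using C[rule_format, of 1 0] by simp
    let ?m = "expect (\<lambda>j. real (count j 0))"
    have count: "integrable (measure_pmf P) (\<lambda>J. real (count J 0))"
      by (intro Bochner_Integration.integrable_bound[OF finite_mean]) (auto simp: count_le_size)
    have "?V N i * (1 - ?m) \<le> 1 + mean * C" for N
    proof -
      have int: "integrable (measure_pmf P) (\<lambda>J. \<Sum>l\<in>#J. \<bar>1 - ?s n (i + l)\<bar>)" for n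
        by (rule integrable_sum_mset[of _ 1]) (use s01 in \<open>simp add: abs_le_iff\<close>)
      have step: "1 - ?s (Suc n) i \<le> expect (\<lambda>J. \<Sum>l\<in>#J. \<bar>1 - ?s n (i + l)\<bar>)" for n
      proof -
        have "1 - ?s (Suc n) i = G (\<lambda>_. 1) - G (\<lambda>l. ?s n (i + l))"
          by (simp add: gen_fun_shift[of P i])
        also have "\<dots> \<le> \<bar>G (\<lambda>_. 1) - G (\<lambda>l. ?s n (i + l))\<bar>"
          by (rule abs_ge_self)
        also have "\<dots> \<le> expect (\<lambda>J. \<Sum>l\<in>#J. \<bar>1 - ?s n (i + l)\<bar>)"
          by (rule abs_diff_gen_fun_le[OF _ s01]) simp
        finally show ?thesis .
      qed
      have swap: "(\<Sum>n<N. \<Sum>l\<in>#J. \<bar>1 - ?s n (i + l)\<bar>) = (\<Sum>l\<in>#J. ?V N (i + l))" for J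
      proof -
        have "\<bar>1 - ?s n x\<bar> = 1 - ?s n x" for n x
          using s01 by simp
        then show ?thesis
          by (simp only:) (induction J, simp_all add: sum.distrib)
      qed
      have "?V N i \<le> ?V (Suc N) i"
        using s01[of N i] by simp
      also have "\<dots> = (1 - ?s 0 i) + (\<Sum>n<N. 1 - ?s (Suc n) i)"
        by (rule sum.lessThan_Suc_shift)
      also have "\<dots> \<le> 1 + (\<Sum>n<N. expect (\<lambda>J. \<Sum>l\<in>#J. \<bar>1 - ?s n (i + l)\<bar>))"
        by (intro add_mono sum_mono step) (use s in simp)
      also have "(\<Sum>n<N. expect (\<lambda>J. \<Sum>l\<in>#J. \<bar>1 - ?s n (i + l)\<bar>)) = expect (\<lambda>J. \<Sum>l\<in>#J. ?V N (i + l))"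
        unfolding swap[symmetric] by (rule Bochner_Integration.integral_sum[symmetric]) (rule int)
      also have "\<dots> \<le> expect (\<lambda>J. real (count J 0) * ?V N i + real (size J) * C)"
      proof (rule integral_mono)
        show "integrable (measure_pmf P) (\<lambda>J. \<Sum>l\<in>#J. ?V N (i + l))"
          unfolding swap[symmetric] by (rule Bochner_Integration.integrable_sum) (rule int)
        show "integrable (measure_pmf P) (\<lambda>J. real (count J 0) * ?V N i + real (size J) * C)"
          by (intro Bochner_Integration.integrable_add integrable_mult_left count finite_mean)
        fix J
        have "?V N (i + l) \<le> (if l = 0 then ?V N i else 0) + C" for l
          using C C0 by auto
        then have "(\<Sum>l\<in>#J. ?V N (i + l)) \<le> (\<Sum>l\<in>#J. (if l = 0 then ?V N i else 0) + C)"
          by (rule sum_mset_mono)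
        also have "\<dots> = real (count J 0) * ?V N i + real (size J) * C"
          by (simp add: sum_mset.distrib sum_mset_delta_0)
        finally show "(\<Sum>l\<in>#J. ?V N (i + l)) \<le> real (count J 0) * ?V N i + real (size J) * C" .
      qed
      also have "\<dots> = ?m * ?V N i + mean * C"
        using count finite_mean by (simp add: mean_def)
      finally show ?thesis
        by (simp add: algebra_simps)
    qed
    then have "?V N i \<le> (1 + mean * C) / (1 - ?m)" for N
      using same_type_mean by (simp add: pos_le_divide_eq)
    then show ?thesis
      by blast
  qed
qed

text \<open>
  By the Borel-Cantelli lemma, as the probabilities of occurrence are summable.
\<close>

lemma AE_eventually_absent:
  "AE \<omega> in gw_space P. \<forall>\<^sub>F n in sequentially. k \<notin># gw_process i \<omega> n"
proof -
  interpret M: prob_space "gw_space P"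
    by (rule prob_space_gw_space)
  let ?s = "(\<lambda>_. 1)(k := 0 :: real)"
  let ?A = "\<lambda>n. {\<omega>. k \<in># gw_process i \<omega> n}"
  let ?p = "\<lambda>n. 1 - ((\<lambda>s i. gen_fun P i s) ^^ n) ?s i"
  have p01: "?p n \<in> {0..1}" for n
    using gen_fun_iterate_unit_interval[of ?s n P i] by simp
  have meas: "measure (gw_space P) (?A n) = ?p n" for n
  proof -
    let ?B = "{\<omega>. k \<notin># gw_process i \<omega> n}"
    have "emeasure (gw_space P) ?B = (\<integral>\<^sup>+\<omega>. indicator ?B \<omega> \<partial>gw_space P)"
      by (rule nn_integral_indicator[symmetric]) (rule sets_gw_process)
    also have "\<dots> = (\<integral>\<^sup>+\<omega>. ennreal (\<Prod>x\<in>#gw_process i \<omega> n. ?s x) \<partial>gw_space P)"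
    proof (rule nn_integral_cong)
      fix \<omega>
      have "(\<Prod>x\<in>#z. ?s x) = (if k \<in># z then 0 else 1)" for z
        by (induction z) auto
      then show "indicator ?B \<omega> = ennreal (\<Prod>x\<in>#gw_process i \<omega> n. ?s x)"
        by (simp add: indicator_def)
    qed
    also have "\<dots> = ennreal (1 - ?p n)"
      by (subst expectation_generation) simp_all
    finally have "measure (gw_space P) ?B = 1 - ?p n"
      using p01[of n] by (simp add: measure_def)
    moreover have "measure (gw_space P) (space (gw_space P) - ?B) = 1 - measure (gw_space P) ?B"
      by (rule M.prob_compl) (rule sets_gw_process)
    moreover have "space (gw_space P) - ?B = ?A n"
      by auto
    ultimately show ?thesis
      by simp
  qed
  have "\<exists>C. \<forall>N. (\<Sum>n<N. ?p n) \<le> C"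
    by (rule summable_occurrence[of _ k]) simp_all
  then obtain C where C: "\<forall>N. (\<Sum>n<N. ?p n) \<le> C" ..
  have "summable ?p"
  proof (rule bounded_imp_summable)
    show "0 \<le> ?p n" for n
      using p01[of n] by simp
    show "(\<Sum>n\<le>N. ?p n) \<le> C" for N
      using C by (simp add: lessThan_Suc_atMost[symmetric] del: sum.lessThan_Suc)
  qed
  then have "AE \<omega> in gw_space P. \<forall>\<^sub>F n in sequentially. \<omega> \<in> space (gw_space P) - ?A n"
    by (intro borel_cantelli_AE1 sets_gw_process) (simp_all add: meas M.emeasure_eq_measure)
  then show ?thesis
    by simp
qed

lemma extinction_prob_finite:
  assumes "finite T"
  shows "extinction_prob P T i = 1"
proof -
  interpret M: prob_space "gw_space P"
    by (rule prob_space_gw_space)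
  have "AE \<omega> in gw_space P. \<forall>k\<in>T. \<forall>\<^sub>F n in sequentially. k \<notin># gw_process i \<omega> n"
    using assms by (intro AE_finite_allI AE_eventually_absent)
  then have "AE \<omega> in gw_space P. \<omega> \<in> extinction_event T i"
    by eventually_elim (use assms in \<open>simp add: extinction_event_def eventually_ball_finite\<close>)
  then show ?thesis
    unfolding extinction_prob_eq by (subst M.prob_eq_1) (rule sets_extinction_event)
qed

lemma extinction_vectors_subcritical:
  assumes "mean \<le> 1"
  shows "extinction_vectors P = {\<lambda>_. 1}"
proof -
  obtain L where L: "L \<in> {0..1}" "total_pgf L = L" "\<forall>T i. L \<le> extinction_prob P T i"
    using extinction_probability_limit by blast
  have "L = 1"
    using less_total_pgf[OF assms, of L] L by force
  have "extinction_prob P T i = 1" for T i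
  proof -
    have "extinction_prob P T i \<le> 1"
      unfolding extinction_prob_eq by (rule prob_space.prob_le_1[OF prob_space_gw_space])
    then show ?thesis
      using L(3) \<open>L = 1\<close> by (simp add: antisym)
  qed
  then have "extinction_prob P T = (\<lambda>_. 1)" for T
    by (rule ext)
  then show ?thesis
    by (simp add: extinction_vectors_def)
qed

end

context supercritical_law
begin

text \<open>
  If the particles with types in the infinite set \<open>T\<close> die out, then all types of \<open>T\<close> beyond some
  level are missed, and a single distant level is missed with probability at most any given number
  above the extinction root.
\<close>

lemma extinction_prob_infinite:
  assumes "infinite T"
  shows "extinction_prob P T i = extinction_root"
proof (rule antisym)
  interpret M: prob_space "gw_space P"
    by (rule prob_space_gw_space)
  obtain L where L: "L \<in> {0..1}" "total_pgf L = L" "\<forall>T i. L \<le> extinction_prob P T i"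
    using extinction_probability_limit by blast
  have "extinction_root \<le> L"
    using less_total_pgf_below_root[of L] L by force
  then show "extinction_root \<le> extinction_prob P T i"
    using L(3) by (meson order_trans)
  show "extinction_prob P T i \<le> extinction_root"
  proof (rule field_le_epsilon)
    fix e :: real assume "e > 0"
    let ?x = "extinction_root + e"
    obtain J where J: "\<forall>j\<ge>J. level_pgf 0 j < ?x"
      using level_pgf_eventually_less[of ?x] \<open>e > 0\<close> unfolding eventually_sequentially by auto
    let ?A = "\<lambda>m. \<Inter>n. {\<omega>. \<forall>l\<in>T \<inter> {m..}. l \<notin># gw_process i \<omega> n}"
    have A_sets: "?A m \<in> sets (gw_space P)" for m
      using sets.top[of "gw_space P"] by (intro sets.countable_INT'' sets_gw_process) simp_all
    have A_le: "measure (gw_space P) (?A m) \<le> ?x" for m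
    proof -
      obtain k where k: "k \<in> T" "k \<ge> m + i + J"
        using assms unfolding infinite_nat_iff_unbounded_le by blast
      have "measure (gw_space P) (?A m) \<le> level_iter 0 n (k - i)" for n
      proof -
        let ?B = "{\<omega>. \<forall>z\<in>set (history i \<omega> n). k \<notin># z}"
        have "?A m \<subseteq> ?B"
          using k by (auto simp: history_def)
        then have "measure (gw_space P) (?A m) \<le> measure (gw_space P) ?B"
          by (rule M.finite_measure_mono) (rule sets_history)
        also have "\<dots> = level_iter 0 n (k - i)"
          using emeasure_avoid[of i n k] k level_iter_unit_interval[of 0 n "k - i"]
          by (simp add: measure_def from_level_def)
        finally show ?thesis .
      qed
      then have "measure (gw_space P) (?A m) \<le> level_pgf 0 (k - i)"
        by (intro LIMSEQ_le_const[OF level_iter_tendsto]) auto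
      also have "\<dots> \<le> ?x"
        using J k by (intro less_imp_le) simp
      finally show ?thesis .
    qed
    have "incseq ?A"
      by (rule incseq_SucI) auto
    then have "(\<lambda>m. measure (gw_space P) (?A m)) \<longlonglongrightarrow> measure (gw_space P) (\<Union>m. ?A m)"
      by (intro M.finite_Lim_measure_incseq) (use A_sets in auto)
    then have "measure (gw_space P) (\<Union>m. ?A m) \<le> ?x"
      by (rule LIMSEQ_le_const2) (use A_le in blast)
    moreover have "extinction_event T i \<subseteq> (\<Union>m. ?A m)"
    proof
      fix \<omega> assume "\<omega> \<in> extinction_event T i"
      then obtain N where N: "\<forall>n\<ge>N. \<forall>l\<in>T. l \<notin># gw_process i \<omega> n"
        unfolding extinction_event_def eventually_sequentially by blast
      obtain m where m: "\<forall>l\<in>(\<Union>n<N. set_mset (gw_process i \<omega> n)). l < m"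
        using finite_nat_set_iff_bounded[of "\<Union>n<N. set_mset (gw_process i \<omega> n)"] by auto
      have "l \<notin># gw_process i \<omega> n" if "l \<in> T \<inter> {m..}" for l n
        using that m N by (cases "n < N") force+
      then show "\<omega> \<in> (\<Union>m. ?A m)"
        by blast
    qed
    then have "measure (gw_space P) (extinction_event T i) \<le> measure (gw_space P) (\<Union>m. ?A m)"
      by (rule M.finite_measure_mono) (use A_sets in blast)
    ultimately show "extinction_prob P T i \<le> extinction_root + e"
      unfolding extinction_prob_eq by linarith
  qed
qed

lemma extinction_vectors_supercritical:
  "extinction_vectors P = {\<lambda>_. extinction_root, \<lambda>_. 1}"
proof -
  have vec: "extinction_prob P T = (if finite T then (\<lambda>_. 1) else (\<lambda>_. extinction_root))" for T
    using extinction_prob_finite extinction_prob_infinite by (auto simp: fun_eq_iff)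
  have "extinction_prob P {} = (\<lambda>_. 1)" "extinction_prob P UNIV = (\<lambda>_. extinction_root)"
    by (simp_all add: vec)
  then have "{\<lambda>_. extinction_root, \<lambda>_. 1} \<subseteq> extinction_vectors P"
    unfolding extinction_vectors_def by (metis (mono_tags, lifting) CollectI empty_subsetI insert_subset)
  moreover have "v \<in> {\<lambda>_. extinction_root, \<lambda>_. 1}" if v: "v \<in> extinction_vectors P" for v
  proof -
    obtain T where "v = extinction_prob P T"
      using v unfolding extinction_vectors_def by blast
    then show ?thesis
      by (simp add: vec)
  qed
  ultimately show ?thesis
    by blast
qed

end

section \<open>The mean matrix\<close>

text \<open>
  The difference quotient of \<open>t\<^sup>c\<close> at 1 is the geometric sum \<open>1 + t + \<dots> + t\<^bsup>c-1\<^esup>\<close>, which increases to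
  \<open>c\<close>; monotone convergence identifies the entries of the mean matrix, finite or not.
\<close>

lemma gen_fun_unit_direction:
  "gen_fun P i ((\<lambda>_. 1)(k := t)) = measure_pmf.expectation P (\<lambda>j. t ^ (if i \<le> k then count j (k - i) else 0))"
proof -
  have "(\<Prod>m\<in>#j. ((\<lambda>_. 1)(k := t)) (i + m)) = t ^ (if i \<le> k then count j (k - i) else 0)" for j
    by (induction j) auto
  then show ?thesis
    unfolding gen_fun_shift[of P i] gen_fun_0 by simp
qed

lemma difference_quotient_eq:
  fixes c :: "'a \<Rightarrow> nat"
  assumes t: "t \<in> {0<..<1}"
  shows "ennreal ((1 - measure_pmf.expectation P (\<lambda>j. t ^ c j)) / (1 - t))
    = (\<integral>\<^sup>+j. ennreal (\<Sum>l<c j. t ^ l) \<partial>measure_pmf P)"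
proof -
  have pow: "t ^ n \<in> {0..1}" for n
    using t by (simp add: power_le_one)
  have geo: "(\<Sum>l<n. t ^ l) = (1 - t ^ n) / (1 - t)" for n
    using one_diff_power_eq[of t n] t by (simp add: field_simps)
  have int: "integrable (measure_pmf P) (\<lambda>j. t ^ c j)"
    by (rule measure_pmf.integrable_const_bound[where B = 1]) (use pow in auto)
  have "(\<integral>\<^sup>+j. ennreal (\<Sum>l<c j. t ^ l) \<partial>measure_pmf P)
      = ennreal (measure_pmf.expectation P (\<lambda>j. (1 - t ^ c j) / (1 - t)))"
    unfolding geo
  proof (rule nn_integral_eq_integral)
    show "integrable (measure_pmf P) (\<lambda>j. (1 - t ^ c j) / (1 - t))"
      using int by simp
    show "AE j in measure_pmf P. 0 \<le> (1 - t ^ c j) / (1 - t)"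
      using pow t by simp
  qed
  also have "measure_pmf.expectation P (\<lambda>j. (1 - t ^ c j) / (1 - t))
      = (1 - measure_pmf.expectation P (\<lambda>j. t ^ c j)) / (1 - t)"
    using int by simp
  finally show ?thesis ..
qed

lemma mean_matrix_eq:
  "mean_matrix P i k = (\<integral>\<^sup>+j. ennreal (real (if i \<le> k then count j (k - i) else 0)) \<partial>measure_pmf P)"
proof -
  let ?c = "\<lambda>j. if i \<le> k then count j (k - i) else 0"
  let ?q = "\<lambda>t. ennreal ((gen_fun P i (\<lambda>_. 1) - gen_fun P i ((\<lambda>_. 1)(k := t))) / (1 - t))"
  have one: "gen_fun P i (\<lambda>_. 1) = 1"
    by (simp add: gen_fun_shift[of P i])
  have "(?q \<longlongrightarrow> (\<integral>\<^sup>+j. ennreal (real (?c j)) \<partial>measure_pmf P)) (at_left 1)"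
  proof (rule tendsto_at_left_sequentially[of 0])
    fix S :: "nat \<Rightarrow> real"
    assume S: "\<And>n. S n < 1" "\<And>n. 0 < S n" "incseq S" "S \<longlonglongrightarrow> 1"
    have "?q (S n) = (\<integral>\<^sup>+j. ennreal (\<Sum>l<?c j. S n ^ l) \<partial>measure_pmf P)" for n
      unfolding one gen_fun_unit_direction by (rule difference_quotient_eq) (use S in simp)
    moreover have "(\<lambda>n. \<integral>\<^sup>+j. ennreal (\<Sum>l<?c j. S n ^ l) \<partial>measure_pmf P)
        \<longlonglongrightarrow> (\<integral>\<^sup>+j. ennreal (real (?c j)) \<partial>measure_pmf P)"
    proof (rule nn_integral_LIMSEQ)
      show "incseq (\<lambda>n j. ennreal (\<Sum>l<?c j. S n ^ l))"
      proof (intro incseq_SucI le_funI ennreal_leI sum_mono power_mono)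
        show "S n \<le> S (Suc n)" "0 \<le> S n" for n
          using S(2)[of n] incseq_SucD[OF S(3)] by simp_all
      qed
      show "(\<lambda>n. ennreal (\<Sum>l<?c j. S n ^ l)) \<longlonglongrightarrow> ennreal (real (?c j))" for j
      proof (rule tendsto_ennrealI)
        have "(\<lambda>n. \<Sum>l<?c j. S n ^ l) \<longlonglongrightarrow> (\<Sum>l<?c j. 1 ^ l)"
          by (intro tendsto_sum tendsto_power S)
        then show "(\<lambda>n. \<Sum>l<?c j. S n ^ l) \<longlonglongrightarrow> real (?c j)"
          by simp
      qed
    qed simp
    ultimately show "(\<lambda>n. ?q (S n)) \<longlonglongrightarrow> (\<integral>\<^sup>+j. ennreal (real (?c j)) \<partial>measure_pmf P)"
      by (simp only:)
  qed simp
  then show ?thesis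
    unfolding mean_matrix_def by (rule tendsto_Lim[OF trivial_limit_at_left_real])
qed

lemma type_mean_eq: "type_mean P k = (\<integral>\<^sup>+j. ennreal (real (count j k)) \<partial>measure_pmf P)"
  by (simp add: type_mean_def mean_matrix_eq)

lemma suminf_count:
  fixes g :: "nat \<Rightarrow> real"
  assumes "\<And>k. 0 \<le> g k"
  shows "(\<Sum>k. ennreal (real (count j k)) * ennreal (g k)) = ennreal (\<Sum>k\<in>#j. g k)"
proof (induction j)
  case (add x j)
  have split: "ennreal (real (count (add_mset x j) k)) * ennreal (g k)
      = (if k = x then ennreal (g x) else 0) + ennreal (real (count j k)) * ennreal (g k)" for k
    using assms by (simp add: ennreal_mult[symmetric] ennreal_plus[symmetric] algebra_simps del: ennreal_plus)
  have "(\<Sum>k. ennreal (real (count (add_mset x j) k)) * ennreal (g k))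
      = (\<Sum>k. if k = x then ennreal (g x) else 0) + (\<Sum>k. ennreal (real (count j k)) * ennreal (g k))"
    unfolding split by (rule suminf_add[symmetric]) auto
  also have "(\<Sum>k. if k = x then ennreal (g x) else 0) = ennreal (g x)"
    by (subst suminf_finite[of "{x}"]) auto
  also have "ennreal (g x) + (\<Sum>k. ennreal (real (count j k)) * ennreal (g k)) = ennreal (\<Sum>k\<in>#add_mset x j. g k)"
    unfolding add using assms sum_mset_nonneg[OF assms] by (simp add: ennreal_plus[symmetric] del: ennreal_plus)
  finally show ?case .
qed simp

lemma suminf_type_mean:
  assumes "\<And>k. 0 \<le> g k"
  shows "(\<Sum>k. type_mean P k * ennreal (g k)) = (\<integral>\<^sup>+j. ennreal (\<Sum>k\<in>#j. g k) \<partial>measure_pmf P)"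
proof -
  have "(\<Sum>k. type_mean P k * ennreal (g k))
      = (\<Sum>k. (\<integral>\<^sup>+j. ennreal (real (count j k)) * ennreal (g k) \<partial>measure_pmf P))"
    by (simp add: type_mean_eq nn_integral_multc)
  also have "\<dots> = (\<integral>\<^sup>+j. (\<Sum>k. ennreal (real (count j k)) * ennreal (g k)) \<partial>measure_pmf P)"
    by (rule nn_integral_suminf[symmetric]) simp
  finally show ?thesis
    unfolding suminf_count[of g, OF assms] .
qed

lemma total_mean_eq: "total_mean P = (\<integral>\<^sup>+j. ennreal (real (size j)) \<partial>measure_pmf P)"
  using suminf_type_mean[of "\<lambda>_. 1" P] by (simp add: total_mean_def)

text \<open>
  The mean matrix is upper triangular and constant along diagonals, so a path from type 0 to type 1
  contains exactly one step to the next type.  Irreducibility therefore forces that a particle can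
  have a child one type up.
\<close>

lemma mat_power_next_type_eq_0:
  assumes "mean_matrix P 0 1 = 0"
  shows "mat_power (mean_matrix P) n 0 1 = 0"
proof (induction n)
  case (Suc n)
  have "mat_power (mean_matrix P) n 0 l * mean_matrix P l 1 = 0" for l
  proof -
    consider "l = 0" | "l = 1" | "l > 1"
      by linarith
    then show ?thesis
    proof cases
      case 3
      then show ?thesis
        by (simp add: mean_matrix_eq)
    qed (use Suc assms in simp_all)
  qed
  then show ?case
    by (simp only: mat_power.simps suminf_zero)
qed simp

lemma offspring_lawI:
  fixes P :: "nat multiset pmf"
  assumes A1: "\<And>i k. i \<le> k \<Longrightarrow> \<exists>n\<ge>1. mat_power (mean_matrix P) n i k > 0"
    and A2: "pmf P {#} > 0"
      "\<And>i. measure (gw_space P) {\<omega> \<in> space (gw_space P). size (gw_process i \<omega> 1) > 1} > 0"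
    and A3: "type_mean P 0 < 1" "total_mean P < \<infinity>"
  shows "offspring_law P"
proof
  show fin: "integrable (measure_pmf P) (\<lambda>j. real (size j))"
    by (rule integrableI_bounded) (use A3(2) in \<open>simp_all add: total_mean_eq\<close>)
  show "pmf P {#} > 0"
    by (rule A2)
  show "measure_pmf.prob P {j. size j > 1} > 0"
  proof -
    have "size (gw_process 0 \<omega> 1) = size (\<omega> (0, 0, 0))" for \<omega>
      unfolding One_nat_def gw_process.simps by (simp add: lessThan_Suc)
    then have "{\<omega>. size (gw_process 0 \<omega> 1) > 1} = (\<lambda>\<omega>. \<omega> (0, 0, 0)) -` {j. size j > 1} \<inter> space (gw_space P)"
      by (simp add: vimage_def)
    also have "measure (gw_space P) \<dots> = measure (distr (gw_space P) (measure_pmf P) (\<lambda>\<omega>. \<omega> (0, 0, 0))) {j. size j > 1}"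
      by (rule measure_distr[symmetric]) (simp_all add: gw_space_def)
    finally have "measure (gw_space P) {\<omega>. size (gw_process 0 \<omega> 1) > 1} = measure_pmf.prob P {j. size j > 1}"
      by (simp only: distr_coordinate)
    then show ?thesis
      using A2(2)[of 0] by simp
  qed
  have count: "integrable (measure_pmf P) (\<lambda>j. real (count j k))" for k
    by (rule Bochner_Integration.integrable_bound[OF fin]) (auto simp: count_le_size)
  show "measure_pmf.expectation P (\<lambda>j. real (count j 0)) < 1"
    using A3(1) nn_integral_eq_integral[OF count, of 0] by (simp add: type_mean_eq)
  show "measure_pmf.prob P {j. 1 \<in># j} > 0"
  proof (rule ccontr)
    assume "\<not> measure_pmf.prob P {j. 1 \<in># j} > 0"
    then have "measure_pmf.prob P {j. 1 \<in># j} = 0"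
      using measure_nonneg[of "measure_pmf P" "{j. 1 \<in># j}"] by linarith
    then have disj: "set_pmf P \<inter> {j. 1 \<in># j} = {}"
      by (simp only: measure_pmf_zero_iff)
    have "count j 1 = 0" if "j \<in> set_pmf P" for j
      using disj that not_in_iff[of 1 j] by blast
    then have "AE j in measure_pmf P. ennreal (real (if (0::nat) \<le> 1 then count j (1 - 0) else 0)) = 0"
      by (intro AE_pmfI) simp
    then have "mean_matrix P 0 1 = 0"
      unfolding mean_matrix_eq by (subst nn_integral_cong_AE[where v = "\<lambda>_. 0"]) auto
    then have "mat_power (mean_matrix P) n 0 1 = 0" for n
      by (rule mat_power_next_type_eq_0)
    then show False
      using A1[of 0 1] by simp
  qed
qed

context offspring_law
begin

lemma total_mean_eq_mean: "total_mean P = ennreal mean"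
  unfolding total_mean_eq mean_def by (rule nn_integral_eq_integral[OF finite_mean]) simp

lemma mean_nonneg: "0 \<le> mean"
  unfolding mean_def by (rule integral_nonneg_AE) simp

lemma characteristic_root_iff:
  assumes "x \<in> {0<..<1}"
  shows "(\<Sum>k. type_mean P k * ennreal (x ^ k)) = 1 \<longleftrightarrow> characteristic_root x"
proof -
  have "integrable (measure_pmf P) (\<lambda>j. \<Sum>k\<in>#j. x ^ k)"
    by (rule integrable_sum_mset[of _ 1]) (use assms in \<open>simp add: power_le_one\<close>)
  moreover have nonneg: "0 \<le> (\<Sum>k\<in>#j. x ^ k)" for j
    by (rule sum_mset_nonneg) (use assms in simp)
  ultimately have "(\<Sum>k. type_mean P k * ennreal (x ^ k)) = ennreal (expect (\<lambda>j. \<Sum>k\<in>#j. x ^ k))"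
    by (subst suminf_type_mean) (use assms in \<open>auto intro!: nn_integral_eq_integral\<close>)
  then show ?thesis
    by (simp add: characteristic_root_def)
qed

end

theorem theorem1p1:
  fixes P :: "nat multiset pmf"
  assumes A1: "\<And>i k. i \<le> k \<Longrightarrow> \<exists>n\<ge>1. mat_power (mean_matrix P) n i k > 0"
    and A2: "pmf P {#} > 0"
      "\<And>i. measure (gw_space P) {\<omega> \<in> space (gw_space P). size (gw_process i \<omega> 1) > 1} > 0"
    and A3: "type_mean P 0 < 1" "total_mean P < \<infinity>"
  shows "(total_mean P \<le> 1 \<longrightarrow>
      extinction_vectors P = {\<lambda>_. 1} \<and> fixed_points P = {\<lambda>_. 1})
    \<and> (total_mean P > 1 \<longrightarrow>
      infinite (fixed_points P) \<and>
      (\<exists>q\<in>{0<..<1}. total_gen_fun P q = q \<and>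
        (\<forall>s\<in>{0<..<1}. total_gen_fun P s = s \<longrightarrow> s = q) \<and>
        extinction_vectors P = {\<lambda>_. q, \<lambda>_. 1}))
    \<and> (\<forall>r \<in> fixed_points P - extinction_vectors P.
      \<exists>\<gamma>\<in>{0<..<1}. (\<Sum>i. type_mean P i * ennreal (\<gamma> ^ i)) = 1 \<and>
        (\<forall>s\<in>{0<..<1}. (\<Sum>i. type_mean P i * ennreal (s ^ i)) = 1 \<longrightarrow> s = \<gamma>) \<and>
        (\<lambda>i. (1 - r (i + 1)) / (1 - r i)) \<longlonglongrightarrow> \<gamma>)"
proof -
  interpret offspring_law P
    by (rule offspring_lawI[OF A1 A2 A3])
  show ?thesis
  proof (cases "mean \<le> 1")
    case True
    then have "total_mean P \<le> 1"
      by (simp add: total_mean_eq_mean)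
    then show ?thesis
      using extinction_vectors_subcritical[OF True] fixed_points_subcritical[OF True] by simp
  next
    case False
    then have "total_mean P > 1"
      using mean_nonneg by (simp add: total_mean_eq_mean)
    interpret supercritical_law P
      by standard (use False in simp)
    let ?q = extinction_root
    have q01: "?q \<in> {0<..<1}"
      by (rule extinction_root_bounds)
    have root: "total_gen_fun P ?q = ?q"
      using total_gen_fun_eq[of ?q P] q01 total_pgf_extinction_root by simp
    have unique: "s = ?q" if "s \<in> {0<..<1}" "total_gen_fun P s = s" for s
      using extinction_root_unique[OF that(1)] that total_gen_fun_eq[of s P] by simp
    have ratio: "\<exists>\<gamma>\<in>{0<..<1}. (\<Sum>i. type_mean P i * ennreal (\<gamma> ^ i)) = 1 \<and>
        (\<forall>s\<in>{0<..<1}. (\<Sum>i. type_mean P i * ennreal (s ^ i)) = 1 \<longrightarrow> s = \<gamma>) \<and>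
        (\<lambda>i. (1 - r (i + 1)) / (1 - r i)) \<longlonglongrightarrow> \<gamma>"
      if r: "r \<in> fixed_points P - extinction_vectors P" for r
    proof -
      have "r \<in> fixed_points P" "r \<noteq> (\<lambda>_. ?q)" "r \<noteq> (\<lambda>_. 1)"
        using r by (auto simp: extinction_vectors_supercritical)
      then obtain \<gamma> where \<gamma>: "\<gamma> \<in> {0<..<1}" "characteristic_root \<gamma>"
        "(\<lambda>i. (1 - r (i + 1)) / (1 - r i)) \<longlonglongrightarrow> \<gamma>"
        using fixed_point_ratio[of r] by blast
      show ?thesis
      proof (intro bexI[OF _ \<gamma>(1)] conjI ballI impI \<gamma>(3))
        show "(\<Sum>i. type_mean P i * ennreal (\<gamma> ^ i)) = 1"
          using \<gamma> by (simp add: characteristic_root_iff)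
        show "s = \<gamma>" if "s \<in> {0<..<1}" "(\<Sum>i. type_mean P i * ennreal (s ^ i)) = 1" for s
          using characteristic_root_unique[of s \<gamma>] characteristic_root_iff[OF that(1)] that \<gamma> by simp
      qed
    qed
    show ?thesis
    proof (intro conjI impI ballI)
      show "extinction_vectors P = {\<lambda>_. 1}" "fixed_points P = {\<lambda>_. 1}" if "total_mean P \<le> 1"
        using that \<open>total_mean P > 1\<close> by simp_all
      show "infinite (fixed_points P)"
        by (rule infinite_fixed_points)
      show "\<exists>q\<in>{0<..<1}. total_gen_fun P q = q \<and>
          (\<forall>s\<in>{0<..<1}. total_gen_fun P s = s \<longrightarrow> s = q) \<and>
          extinction_vectors P = {\<lambda>_. q, \<lambda>_. 1}"
        by (intro bexI[OF _ q01] conjI ballI impI root unique extinction_vectors_supercritical)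
    qed (rule ratio)
  qed
qed

end
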